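(* Let $R$ be an arithmetic ring. Then: (1) $\lambda\text{-}\dim(R)\le 3$; (2) if moreover $R$ is reduced, then $\lambda\text{-}\dim(R)\le 2$.
   Context: All rings are commutative with identity. A ring $R$ is a valuation ring if its ideals are totally ordered by inclusion, and $R$ is arithmetic if $R_M$ is a valuation ring for every maximal ideal $M$ of $R$. An $R$-module $E$ has a finite $n$-presentation if there is an exact sequence $F_n\to F_{n-1}\to\cdots\to F_1\to F_0\to E\to 0$ with each $F_i$ a free $R$-module of finite rank. Put $\lambda_R(E)=\sup\{n : E \text{ has a finite } n\text{-presentation}\}$ (and $\lambda_R(E)=-1$ if $E$ is not finitely generated). The $\lambda$-dimension $\lambda\text{-}\dim(R)$ is the least integer $n$ (or $\infty$ if none exists) such that for every $R$-module $E$, $\lambda_R(E)\ge n$ implies $\lambda_R(E)=\infty$. *)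

theory Defs
  imports Main "HOL-Library.Extended_Real"
begin

definition is_ideal :: "'a::comm_ring_1 set \<Rightarrow> bool" where
  "is_ideal I \<longleftrightarrow> 0 \<in> I \<and> (\<forall>x\<in>I. \<forall>y\<in>I. x + y \<in> I) \<and> (\<forall>r. \<forall>x\<in>I. r * x \<in> I)"

definition maximal_ideal :: "'a::comm_ring_1 set \<Rightarrow> bool" where
  "maximal_ideal M \<longleftrightarrow> is_ideal M \<and> M \<noteq> UNIV \<and>
     (\<forall>J. is_ideal J \<and> M \<subseteq> J \<longrightarrow> J = M \<or> J = UNIV)"

definition reduced_ring :: "'a::comm_ring_1 itself \<Rightarrow> bool" where
  "reduced_ring _ \<longleftrightarrow> (\<forall>(x::'a) (n::nat). x ^ n = 0 \<longrightarrow> x = 0)"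

definition loc_rel :: "'a::comm_ring_1 set \<Rightarrow> (('a \<times> 'a) \<times> ('a \<times> 'a)) set" where
  "loc_rel M = {((a, s), (b, t)). s \<notin> M \<and> t \<notin> M \<and> (\<exists>u. u \<notin> M \<and> u * (a * t - b * s) = 0)}"

definition loc_class :: "'a::comm_ring_1 set \<Rightarrow> 'a \<Rightarrow> 'a \<Rightarrow> ('a \<times> 'a) set" where
  "loc_class M a s = loc_rel M `` {(a, s)}"

definition loc_carrier :: "'a::comm_ring_1 set \<Rightarrow> ('a \<times> 'a) set set" where
  "loc_carrier M = {loc_class M a s | a s. s \<notin> M}"

definition loc_add :: "'a::comm_ring_1 set \<Rightarrow> ('a \<times> 'a) set \<Rightarrow> ('a \<times> 'a) set \<Rightarrow> ('a \<times> 'a) set" where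
  "loc_add M X Y = (let (a, s) = (SOME p. p \<in> X); (b, t) = (SOME q. q \<in> Y)
                    in loc_class M (a * t + b * s) (s * t))"

definition loc_mult :: "'a::comm_ring_1 set \<Rightarrow> ('a \<times> 'a) set \<Rightarrow> ('a \<times> 'a) set \<Rightarrow> ('a \<times> 'a) set" where
  "loc_mult M X Y = (let (a, s) = (SOME p. p \<in> X); (b, t) = (SOME q. q \<in> Y)
                     in loc_class M (a * b) (s * t))"

definition loc_ideal :: "'a::comm_ring_1 set \<Rightarrow> ('a \<times> 'a) set set \<Rightarrow> bool" where
  "loc_ideal M I \<longleftrightarrow> I \<subseteq> loc_carrier M \<and> loc_class M 0 1 \<in> I \<and>
     (\<forall>X\<in>I. \<forall>Y\<in>I. loc_add M X Y \<in> I) \<and>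
     (\<forall>Z\<in>loc_carrier M. \<forall>X\<in>I. loc_mult M Z X \<in> I)"

definition loc_valuation :: "'a::comm_ring_1 set \<Rightarrow> bool" where
  "loc_valuation M \<longleftrightarrow> (\<forall>I J. loc_ideal M I \<and> loc_ideal M J \<longrightarrow> I \<subseteq> J \<or> J \<subseteq> I)"

definition arithmetic_ring :: "'a::comm_ring_1 itself \<Rightarrow> bool" where
  "arithmetic_ring _ \<longleftrightarrow> (\<forall>M::'a set. maximal_ideal M \<longrightarrow> loc_valuation M)"

definition fvec :: "nat \<Rightarrow> (nat \<Rightarrow> 'a::zero) set" where
  "fvec k = {v. \<forall>i\<ge>k. v i = 0}"

definition mat_app :: "(nat \<Rightarrow> nat \<Rightarrow> 'a::comm_ring_1) \<Rightarrow> nat \<Rightarrow> nat \<Rightarrow> (nat \<Rightarrow> 'a) \<Rightarrow> (nat \<Rightarrow> 'a)" where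
  "mat_app A m k v = (\<lambda>i. if i < m then (\<Sum>j<k. A i j * v j) else 0)"

definition aug :: "('a::comm_ring_1 \<Rightarrow> 'b::ab_group_add \<Rightarrow> 'b) \<Rightarrow> (nat \<Rightarrow> 'b) \<Rightarrow> nat \<Rightarrow> (nat \<Rightarrow> 'a) \<Rightarrow> 'b" where
  "aug scale g k v = (\<Sum>j<k. scale (v j) (g j))"

text \<open>E (the whole type 'b with scalar multiplication scale) has a finite n-presentation
  F_n \<rightarrow> ... \<rightarrow> F_0 \<rightarrow> E \<rightarrow> 0 with F_i = R^(k i), d_i = D i : F_i \<rightarrow> F_(i-1).\<close>
definition has_fin_pres :: "('a::comm_ring_1 \<Rightarrow> 'b::ab_group_add \<Rightarrow> 'b) \<Rightarrow> nat \<Rightarrow> bool" where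
  "has_fin_pres scale n \<longleftrightarrow>
    (\<exists>(k::nat \<Rightarrow> nat) (D::nat \<Rightarrow> nat \<Rightarrow> nat \<Rightarrow> 'a) (g::nat \<Rightarrow> 'b).
       (\<forall>x. \<exists>v\<in>fvec (k 0). aug scale g (k 0) v = x) \<and>
       (1 \<le> n \<longrightarrow> {v \<in> fvec (k 0). aug scale g (k 0) v = 0}
                   = mat_app (D 1) (k 0) (k 1) ` fvec (k 1)) \<and>
       (\<forall>i. 1 \<le> i \<and> i < n \<longrightarrow>
          {v \<in> fvec (k i). mat_app (D i) (k (i - 1)) (k i) v = (\<lambda>_. 0)}
            = mat_app (D (Suc i)) (k i) (k (Suc i)) ` fvec (k (Suc i))))"

definition lambda_R :: "('a::comm_ring_1 \<Rightarrow> 'b::ab_group_add \<Rightarrow> 'b) \<Rightarrow> ereal" where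
  "lambda_R scale = (if \<not> has_fin_pres scale 0 then -1
                     else Sup {ereal (real n) | n. has_fin_pres scale n})"

end

theory Submission
  imports Defs "HOL-Library.Function_Algebras"
begin

text \<open>
  It suffices to treat an exact sequence \<open>F\<^sub>3 \<rightarrow> F\<^sub>2 \<rightarrow> F\<^sub>1 \<rightarrow> F\<^sub>0\<close> of finite free modules with maps
  \<open>A\<^sub>3, A\<^sub>2, A\<^sub>1\<close> and to show that \<open>ker A\<^sub>3\<close> is finitely generated near each maximal ideal \<open>M\<close>.
  Over the valuation ring \<open>R\<^sub>M\<close> the matrix \<open>A\<^sub>2\<close> becomes diagonal with entries \<open>b\<^sub>i\<close>. Exactness at \<open>F\<^sub>1\<close> says
  \<open>R b\<^sub>i = (0 : V\<^sub>i)\<close>, where \<open>V\<^sub>i\<close> is the image of the \<open>i\<close>-th basis vector under \<open>A\<^sub>1\<close>; exactness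
  at \<open>F\<^sub>2\<close> makes \<open>(0 : b\<^sub>i)\<close> finitely generated, hence principal, say \<open>R c\<^sub>i\<close>. Then
  \<open>(0 : c\<^sub>i) = (0 : (0 : (0 : V\<^sub>i))) = (0 : V\<^sub>i) = R b\<^sub>i\<close>, and \<open>ker A\<^sub>3\<close> is generated by multiples of lifts of
  the vectors \<open>c\<^sub>i e\<^sub>i\<close> by \<open>b\<^sub>i\<close> together with finitely many explicit vectors. If \<open>R\<close> is reduced then
  \<open>R\<^sub>M\<close> is a domain, so \<open>b\<^sub>i V\<^sub>i = 0\<close> forces \<open>b\<^sub>i = 0\<close> or \<open>V\<^sub>i = 0\<close>, and in the latter case \<open>b\<^sub>i\<close> is a unit;
  hence already \<open>ker A\<^sub>2\<close> is finitely generated near \<open>M\<close>. No localized modules are formed: identities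
  over \<open>R\<^sub>M\<close> are replaced by identities over \<open>R\<close> up to a factor outside \<open>M\<close>.
\<close>

section \<open>Maximal ideals and localization\<close>

lemma is_ideal_Un_chain:
  assumes "subset.chain {I. is_ideal I \<and> 1 \<notin> I} C" "C \<noteq> {}"
  shows "is_ideal (\<Union>C)" "1 \<notin> \<Union>C"
proof -
  have id: "is_ideal I" "1 \<notin> I" if "I \<in> C" for I
    using assms(1) that by (auto simp: subset.chain_def)
  have lin: "I \<subseteq> J \<or> J \<subseteq> I" if "I \<in> C" "J \<in> C" for I J
    using assms(1) that by (auto simp: subset.chain_def)
  show "is_ideal (\<Union>C)"
    unfolding is_ideal_def
  proof (intro conjI ballI allI)
    show "0 \<in> \<Union>C"
      using assms(2) id(1) by (auto simp: is_ideal_def)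
    show "x + y \<in> \<Union>C" if xy: "x \<in> \<Union>C" "y \<in> \<Union>C" for x y
    proof -
      obtain I J where "I \<in> C" "x \<in> I" "J \<in> C" "y \<in> J"
        using xy by blast
      then obtain K where "K \<in> C" "x \<in> K" "y \<in> K"
        using lin by blast
      with id(1) show ?thesis
        by (auto simp: is_ideal_def)
    qed
    show "r * x \<in> \<Union>C" if "x \<in> \<Union>C" for r x
      using that id(1) unfolding is_ideal_def by (meson UnionE UnionI)
  qed
  show "1 \<notin> \<Union>C"
    using id(2) by blast
qed

lemma is_ideal_UNIV_iff:
  assumes "is_ideal I"
  shows "I = UNIV \<longleftrightarrow> 1 \<in> I"
proof
  assume "1 \<in> I"
  with assms have "x * 1 \<in> I" for x
    unfolding is_ideal_def by blast
  then show "I = UNIV"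
    by auto
qed auto

text \<open>Properness is expressed as \<open>1\<close> not lying in the ideal, a condition that
  passes to unions of chains, so Zorn's lemma applies.\<close>

lemma exists_maximal_ideal:
  assumes "is_ideal I" "1 \<notin> I"
  obtains M where "maximal_ideal M" "I \<subseteq> M"
proof -
  let ?A = "{J. is_ideal J \<and> 1 \<notin> J \<and> I \<subseteq> J}"
  have "\<exists>M\<in>?A. \<forall>X\<in>?A. M \<subseteq> X \<longrightarrow> X = M"
  proof (rule subset_Zorn_nonempty)
    show "?A \<noteq> {}"
      using assms by blast
    fix C assume C: "C \<noteq> {}" "subset.chain ?A C"
    then have "subset.chain {I. is_ideal I \<and> 1 \<notin> I} C"
      by (auto simp: subset.chain_def)
    moreover have "I \<subseteq> \<Union>C"
      using C by (force simp: subset.chain_def)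
    ultimately show "\<Union>C \<in> ?A"
      using is_ideal_Un_chain C(1) by blast
  qed
  then obtain M where M: "M \<in> ?A" "\<forall>X\<in>?A. M \<subseteq> X \<longrightarrow> X = M"
    by blast
  have "maximal_ideal M"
    unfolding maximal_ideal_def
  proof (intro conjI allI impI)
    show "is_ideal M" "M \<noteq> UNIV"
      using M(1) by auto
    show "J = M \<or> J = UNIV" if J: "is_ideal J \<and> M \<subseteq> J" for J
      using M J is_ideal_UNIV_iff[of J] by auto
  qed
  with M(1) that show thesis
    by blast
qed

text \<open>For \<open>s\<close> outside \<open>M\<close> the ideal \<open>M + R s\<close> is the
  whole ring, so \<open>1 = m + r * s\<close>; multiplying by \<open>t\<close> would put
  \<open>t\<close> into \<open>M\<close> as soon as \<open>s * t\<close> lies there.\<close>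

lemma maximal_ideal_mult_notin:
  assumes M: "maximal_ideal M" and "s \<notin> M" "t \<notin> M"
  shows "s * t \<notin> M"
proof
  assume st: "s * t \<in> M"
  have id: "is_ideal M"
    using M by (simp add: maximal_ideal_def)
  let ?J = "{m + r * s | m r. m \<in> M}"
  have "is_ideal ?J"
    unfolding is_ideal_def
  proof (intro conjI ballI allI)
    show "0 \<in> ?J"
      using id by (auto simp: is_ideal_def intro!: exI[of _ 0])
    show "x + y \<in> ?J" if xy: "x \<in> ?J" "y \<in> ?J" for x y
    proof -
      obtain m r m' r' where "x = m + r * s" "y = m' + r' * s" "m \<in> M" "m' \<in> M"
        using xy by blast
      then have "x + y = (m + m') + (r + r') * s" "m + m' \<in> M"
        using id by (auto simp: is_ideal_def algebra_simps)
      then show ?thesis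
        by blast
    qed
    show "c * x \<in> ?J" if x: "x \<in> ?J" for c x
    proof -
      obtain m r where "x = m + r * s" "m \<in> M"
        using x by blast
      then have "c * x = c * m + (c * r) * s" "c * m \<in> M"
        using id by (auto simp: is_ideal_def algebra_simps)
      then show ?thesis
        by blast
    qed
  qed
  moreover have "M \<subseteq> ?J"
  proof
    fix m assume "m \<in> M"
    then have "m = m + 0 * s \<and> m \<in> M"
      by simp
    then show "m \<in> ?J"
      by blast
  qed
  moreover have "s \<in> ?J"
    using id by (intro CollectI exI[of _ 0] exI[of _ 1]) (simp add: is_ideal_def)
  ultimately have "?J = UNIV"
    using M assms(2) unfolding maximal_ideal_def by blast
  then obtain m r where "1 = m + r * s" "m \<in> M"
    by blast
  then have "t = t * m + r * (s * t)"
    by (metis distrib_left mult.commute mult.left_commute mult.right_neutral)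
  also have "\<dots> \<in> M"
    using id st \<open>m \<in> M\<close> by (auto simp: is_ideal_def)
  finally show False
    using \<open>t \<notin> M\<close> by simp
qed

text \<open>Encodes inside \<open>R\<close> that \<open>R_M\<close> is a valuation ring: elements
  outside \<open>M\<close> are the denominators, and \<open>s * a = r * b\<close> with
  \<open>s\<close> outside \<open>M\<close> says that \<open>b\<close> divides \<open>a\<close> in
  \<open>R_M\<close>.\<close>

locale valuation_at =
  fixes M :: "'a::comm_ring_1 set"
  assumes one_notin: "1 \<notin> M"
    and mult_notin: "s \<notin> M \<Longrightarrow> t \<notin> M \<Longrightarrow> s * t \<notin> M"
    and comparable: "\<exists>s r. s \<notin> M \<and> (s * a = r * b \<or> s * b = r * a)"
begin

text \<open>Divisibility at \<open>M\<close> is total, so a finite family has a member dividing all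
  the others. Each new element is compared with the current divisor, and \<open>s\<close>
  accumulates the denominators.\<close>

lemma exists_divisor_of_all:
  assumes "finite L" "L \<noteq> {}"
  shows "\<exists>m\<in>L. \<exists>s. s \<notin> M \<and> (\<forall>l\<in>L. \<exists>z. s * c l = z * c m)"
  using assms
proof (induction rule: finite_ne_induct)
  case (singleton x)
  then show ?case
    using one_notin by auto
next
  case (insert x F)
  then obtain m s where m: "m \<in> F" "s \<notin> M" and div: "\<forall>l\<in>F. \<exists>z. s * c l = z * c m"
    by blast
  obtain u r where u: "u \<notin> M" and ur: "u * c x = r * c m \<or> u * c m = r * c x"
    using comparable by blast
  from ur show ?case
  proof
    assume r: "u * c x = r * c m"
    have "\<exists>z. (s * u) * c l = z * c m" if "l \<in> insert x F" for l
    proof (cases "l = x")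
      case True
      then have "(s * u) * c l = (s * r) * c m"
        by (simp only: r mult.assoc)
      then show ?thesis
        by blast
    next
      case False
      with that have "l \<in> F"
        by simp
      with div obtain z where z: "s * c l = z * c m"
        by blast
      have "(s * u) * c l = u * (s * c l)"
        by (simp only: ac_simps)
      then have "(s * u) * c l = (u * z) * c m"
        by (simp only: z mult.assoc)
      then show ?thesis
        by blast
    qed
    with m(1) mult_notin[OF m(2) u] show ?thesis
      by blast
  next
    assume r: "u * c m = r * c x"
    have "\<exists>z. (s * u) * c l = z * c x" if "l \<in> insert x F" for l
    proof (cases "l = x")
      case False
      with that have "l \<in> F"
        by simp
      with div obtain z where z: "s * c l = z * c m"
        by blast
      have "(s * u) * c l = u * (s * c l)"
        by (simp only: ac_simps)
      also have "\<dots> = z * (u * c m)"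
        by (simp only: z ac_simps)
      finally have "(s * u) * c l = (z * r) * c x"
        by (simp only: r mult.assoc)
      then show ?thesis
        by blast
    qed auto
    with mult_notin[OF m(2) u] show ?thesis
      by blast
  qed
qed

text \<open>Products of denominators stay outside \<open>M\<close>, and \<open>P\<close> survives
  multiplication of its factor, so finitely many local statements share one denominator.\<close>

lemma exists_common_multiplier:
  assumes "finite L" "\<And>l. l \<in> L \<Longrightarrow> \<exists>s. s \<notin> M \<and> P l s"
    and "\<And>l s t. P l s \<Longrightarrow> P l (t * s)"
  shows "\<exists>s. s \<notin> M \<and> (\<forall>l\<in>L. P l s)"
  using assms(1,2)
proof (induction rule: finite_induct)
  case empty
  then show ?case
    using one_notin by blast
next
  case (insert x F)
  then obtain s t where "s \<notin> M" "\<forall>l\<in>F. P l s" "t \<notin> M" "P x t"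
    by blast
  moreover from this have "P l (s * t)" if "l \<in> insert x F" for l
    using that assms(3)[of x t s] assms(3)[of l s t] by (auto simp: mult.commute[of t s])
  ultimately have "s * t \<notin> M" "\<forall>l\<in>insert x F. P l (s * t)"
    using mult_notin by blast+
  then show ?case
    by blast
qed

end

section \<open>Arithmetic of fractions with denominators outside a maximal ideal\<close>

context
  fixes M :: "'a::comm_ring_1 set"
  assumes M: "maximal_ideal M"
begin

lemma maximal_one_notin: "1 \<notin> M"
  using M is_ideal_UNIV_iff[of M] by (auto simp: maximal_ideal_def)

lemma loc_relI: "s \<notin> M \<Longrightarrow> t \<notin> M \<Longrightarrow> u \<notin> M \<Longrightarrow> u * (a * t - b * s) = 0 \<Longrightarrow> ((a, s), (b, t)) \<in> loc_rel M"
  by (auto simp: loc_rel_def)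

lemma loc_rel_trans:
  assumes "((a, s), (b, t)) \<in> loc_rel M" "((b, t), (c, w)) \<in> loc_rel M"
  shows "((a, s), (c, w)) \<in> loc_rel M"
proof -
  obtain u v where u: "u \<notin> M" "u * (a * t - b * s) = 0" and v: "v \<notin> M" "v * (b * w - c * t) = 0"
    and stw: "s \<notin> M" "t \<notin> M" "w \<notin> M"
    using assms by (auto simp: loc_rel_def)
  \<comment> \<open>Eliminating the middle fraction \<open>b / t\<close> costs the additional factor
    \<open>t\<close> in the witness.\<close>
  have "(u * v * t) * (a * w - c * s) = v * w * (u * (a * t - b * s)) + u * s * (v * (b * w - c * t))"
    by (simp add: algebra_simps)
  also have "\<dots> = 0"
    by (simp add: u v)
  finally show ?thesis
    by (intro loc_relI[of _ _ "u * v * t"] maximal_ideal_mult_notin[OF M] u v stw)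
qed

lemma loc_rel_sym:
  assumes "((a, s), (b, t)) \<in> loc_rel M"
  shows "((b, t), (a, s)) \<in> loc_rel M"
proof -
  obtain u where "u \<notin> M" "u * (a * t - b * s) = 0" "s \<notin> M" "t \<notin> M"
    using assms by (auto simp: loc_rel_def)
  moreover have "u * (b * s - a * t) = - (u * (a * t - b * s))"
    by (simp add: algebra_simps)
  ultimately show ?thesis
    by (intro loc_relI[of _ _ u]) simp_all
qed

lemma loc_rel_refl: "s \<notin> M \<Longrightarrow> ((a, s), (a, s)) \<in> loc_rel M"
  using maximal_one_notin by (auto simp: loc_rel_def)

lemma loc_class_eq_iff:
  assumes "s \<notin> M"
  shows "loc_class M a s = loc_class M b t \<longleftrightarrow> ((a, s), (b, t)) \<in> loc_rel M"
proof
  assume "loc_class M a s = loc_class M b t"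
  then show "((a, s), (b, t)) \<in> loc_rel M"
    using loc_rel_refl[OF assms, of a] loc_rel_sym unfolding loc_class_def by blast
next
  assume "((a, s), (b, t)) \<in> loc_rel M"
  then show "loc_class M a s = loc_class M b t"
    unfolding loc_class_def by (auto intro: loc_rel_trans dest: loc_rel_sym)
qed

text \<open>\<open>loc_add\<close> and \<open>loc_mult\<close> compute with the pair picked by
  \<open>SOME\<close>; this names that pair and shows that it represents the same fraction.\<close>

lemma loc_class_representative:
  assumes "s \<notin> M"
  obtains a' s' where "(SOME p. p \<in> loc_class M a s) = (a', s')"
    "s' \<notin> M" "loc_class M a s = loc_class M a' s'"
proof -
  obtain a' s' where p: "(SOME p. p \<in> loc_class M a s) = (a', s')"
    by fastforce
  have "(a, s) \<in> loc_class M a s"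
    using loc_rel_refl[OF assms] by (simp add: loc_class_def)
  then have "(a', s') \<in> loc_class M a s"
    by (metis p someI)
  then have "((a, s), (a', s')) \<in> loc_rel M"
    by (simp add: loc_class_def)
  moreover from this have "s' \<notin> M"
    by (simp add: loc_rel_def)
  ultimately show thesis
    using that[OF p] loc_class_eq_iff[OF assms, of a a' s'] by blast
qed

lemma loc_add_class:
  assumes "s \<notin> M" "t \<notin> M"
  shows "loc_add M (loc_class M a s) (loc_class M b t) = loc_class M (a * t + b * s) (s * t)"
proof -
  obtain a' s' where a': "(SOME p. p \<in> loc_class M a s) = (a', s')" "s' \<notin> M"
    "loc_class M a s = loc_class M a' s'"
    by (rule loc_class_representative[OF assms(1), of a])
  obtain b' t' where b': "(SOME p. p \<in> loc_class M b t) = (b', t')" "t' \<notin> M"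
    "loc_class M b t = loc_class M b' t'"
    by (rule loc_class_representative[OF assms(2), of b])
  obtain u where u: "u \<notin> M" "u * (a' * s - a * s') = 0"
    using loc_class_eq_iff[OF a'(2), of a' a s] a'(3) by (auto simp: loc_rel_def)
  obtain v where v: "v \<notin> M" "v * (b' * t - b * t') = 0"
    using loc_class_eq_iff[OF b'(2), of b' b t] b'(3) by (auto simp: loc_rel_def)
  have eq: "(u * v) * ((a' * t' + b' * s') * (s * t) - (a * t + b * s) * (s' * t'))
      = v * t * t' * (u * (a' * s - a * s')) + u * s * s' * (v * (b' * t - b * t'))"
    by (simp add: algebra_simps)
  have "((a' * t' + b' * s', s' * t'), (a * t + b * s, s * t)) \<in> loc_rel M"
    by (rule loc_relI[of _ _ "u * v"])
      (simp_all only: maximal_ideal_mult_notin[OF M] a'(2) b'(2) assms u v eq mult_zero_right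
        add_0_right not_False_eq_True)
  then show ?thesis
    using loc_class_eq_iff[OF maximal_ideal_mult_notin[OF M a'(2) b'(2)]]
    by (simp add: loc_add_def a'(1) b'(1))
qed

lemma loc_mult_class:
  assumes "s \<notin> M" "t \<notin> M"
  shows "loc_mult M (loc_class M a s) (loc_class M b t) = loc_class M (a * b) (s * t)"
proof -
  obtain a' s' where a': "(SOME p. p \<in> loc_class M a s) = (a', s')" "s' \<notin> M"
    "loc_class M a s = loc_class M a' s'"
    by (rule loc_class_representative[OF assms(1), of a])
  obtain b' t' where b': "(SOME p. p \<in> loc_class M b t) = (b', t')" "t' \<notin> M"
    "loc_class M b t = loc_class M b' t'"
    by (rule loc_class_representative[OF assms(2), of b])
  obtain u where u: "u \<notin> M" "u * (a' * s - a * s') = 0"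
    using loc_class_eq_iff[OF a'(2), of a' a s] a'(3) by (auto simp: loc_rel_def)
  obtain v where v: "v \<notin> M" "v * (b' * t - b * t') = 0"
    using loc_class_eq_iff[OF b'(2), of b' b t] b'(3) by (auto simp: loc_rel_def)
  have eq: "(u * v) * ((a' * b') * (s * t) - (a * b) * (s' * t'))
      = v * b' * t * (u * (a' * s - a * s')) + u * a * s' * (v * (b' * t - b * t'))"
    by (simp add: algebra_simps)
  have "((a' * b', s' * t'), (a * b, s * t)) \<in> loc_rel M"
    by (rule loc_relI[of _ _ "u * v"])
      (simp_all only: maximal_ideal_mult_notin[OF M] a'(2) b'(2) assms u v eq mult_zero_right
        add_0_right not_False_eq_True)
  then show ?thesis
    using loc_class_eq_iff[OF maximal_ideal_mult_notin[OF M a'(2) b'(2)]]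
    by (simp add: loc_mult_def a'(1) b'(1))
qed

text \<open>The set is the principal ideal of \<open>R_M\<close> generated by \<open>a / 1\<close>.
  Such ideals suffice to compare elements.\<close>

lemma loc_ideal_principal: "loc_ideal M {loc_class M (r * a) s | r s. s \<notin> M}"
  unfolding loc_ideal_def
proof (intro conjI ballI)
  let ?I = "{loc_class M (r * a) s | r s. s \<notin> M}"
  show "?I \<subseteq> loc_carrier M"
    by (auto simp: loc_carrier_def)
  show "loc_class M 0 1 \<in> ?I"
    using maximal_one_notin by (intro CollectI exI[of _ 0] exI[of _ 1]) auto
  show "loc_add M X Y \<in> ?I" if XY: "X \<in> ?I" "Y \<in> ?I" for X Y
  proof -
    obtain r s r' s' where *: "X = loc_class M (r * a) s" "s \<notin> M" "Y = loc_class M (r' * a) s'" "s' \<notin> M"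
      using XY by blast
    then have "loc_add M X Y = loc_class M ((r * s' + r' * s) * a) (s * s')"
      by (simp add: loc_add_class algebra_simps)
    with maximal_ideal_mult_notin[OF M *(2,4)] show ?thesis
      by blast
  qed
  show "loc_mult M Z X \<in> ?I" if ZX: "Z \<in> loc_carrier M" "X \<in> ?I" for Z X
  proof -
    obtain r s c t where *: "X = loc_class M (r * a) s" "s \<notin> M" "Z = loc_class M c t" "t \<notin> M"
      using ZX unfolding loc_carrier_def by blast
    then have "loc_mult M Z X = loc_class M ((c * r) * a) (t * s)"
      by (simp add: loc_mult_class algebra_simps)
    with maximal_ideal_mult_notin[OF M *(4,2)] show ?thesis
      by blast
  qed
qed

text \<open>Inclusion of principal ideals of \<open>R_M\<close> gives
  \<open>a / 1 = (r * b) / s\<close>, and clearing denominators yields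
  \<open>u * s * a = u * r * b\<close> over \<open>R\<close>.\<close>

lemma valuation_at_maximal:
  assumes "loc_valuation M"
  shows "valuation_at M"
proof
  show "1 \<notin> M"
    by (rule maximal_one_notin)
  show "s * t \<notin> M" if "s \<notin> M" "t \<notin> M" for s t
    using maximal_ideal_mult_notin[OF M that] .
  let ?I = "\<lambda>a. {loc_class M (r * a) s | r s. s \<notin> M}"
  have key: "\<exists>s r. s \<notin> M \<and> s * a = r * b" if "?I a \<subseteq> ?I b" for a b
  proof -
    have "loc_class M (1 * a) 1 \<in> ?I a"
      using maximal_one_notin by blast
    then have "loc_class M (1 * a) 1 \<in> ?I b"
      using that by blast
    then obtain r s where "loc_class M a 1 = loc_class M (r * b) s" "s \<notin> M"
      by auto
    then obtain u where "u \<notin> M" "u * (a * s - r * b) = 0"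
      using loc_class_eq_iff[OF maximal_one_notin] by (auto simp: loc_rel_def)
    then have "(u * s) * a = (u * r) * b"
      by (simp add: algebra_simps)
    moreover have "u * s \<notin> M"
      using maximal_ideal_mult_notin[OF M \<open>u \<notin> M\<close> \<open>s \<notin> M\<close>] .
    ultimately show ?thesis
      by blast
  qed
  show "\<exists>s r. s \<notin> M \<and> (s * a = r * b \<or> s * b = r * a)" for a b
  proof -
    have "?I a \<subseteq> ?I b \<or> ?I b \<subseteq> ?I a"
      using assms loc_ideal_principal[of a] loc_ideal_principal[of b]
      unfolding loc_valuation_def by blast
    then show ?thesis
      using key[of a b] key[of b a] by blast
  qed
qed

end

section \<open>Diagonalization at a maximal ideal\<close>

text \<open>Scalar multiplication on all sequences; each free module \<open>R^n\<close> is the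
  submodule \<open>fvec n\<close>, so all maps live on one type.\<close>

definition smul :: "'a::comm_ring_1 \<Rightarrow> (nat \<Rightarrow> 'a) \<Rightarrow> nat \<Rightarrow> 'a" where
  "smul r v = (\<lambda>i. r * v i)"

lemma smul_apply [simp]: "smul r v i = r * v i"
  by (simp add: smul_def)

interpretation vec: module "smul :: 'a::comm_ring_1 \<Rightarrow> _"
  by unfold_locales (auto simp: fun_eq_iff algebra_simps)

abbreviation linear_map :: "((nat \<Rightarrow> 'a::comm_ring_1) \<Rightarrow> nat \<Rightarrow> 'a) \<Rightarrow> bool" where
  "linear_map \<equiv> module_hom smul smul"

lemma linear_mapI:
  assumes "\<And>u v. A (u + v) = A u + A v" "\<And>r v. A (smul r v) = smul r (A v)"
  shows "linear_map A"
  using assms by unfold_locales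

lemma linear_map_comp: "linear_map A \<Longrightarrow> linear_map B \<Longrightarrow> linear_map (\<lambda>v. A (B v))"
  using module_hom_compose[of smul smul B smul A] by (simp add: o_def)

lemma sum_fun_apply [simp]: "(\<Sum>x\<in>A. f x) i = (\<Sum>x\<in>A. f x i)" for f :: "'c \<Rightarrow> 'd \<Rightarrow> 'e::comm_monoid_add"
  by (induction A rule: infinite_finite_induct) simp_all

section \<open>Standard basis of the free modules\<close>

definition unit_vec :: "nat \<Rightarrow> nat \<Rightarrow> 'a::comm_ring_1" where
  "unit_vec j = (\<lambda>i. if i = j then 1 else 0)"

lemma unit_vec_apply: "unit_vec j i = (if i = j then 1 else 0)"
  by (simp add: unit_vec_def)

lemma subspace_fvec: "vec.subspace (fvec n)"
  by (auto simp: vec.subspace_def fvec_def)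

lemma unit_vec_in_fvec [simp]: "j < n \<Longrightarrow> unit_vec j \<in> fvec n"
  by (auto simp: fvec_def unit_vec_def)

lemma fvec_expansion:
  fixes v :: "nat \<Rightarrow> 'a::comm_ring_1"
  assumes "v \<in> fvec n"
  shows "v = (\<Sum>j<n. smul (v j) (unit_vec j))"
proof
  fix i
  have "(\<Sum>j<n. v j * unit_vec j i) = (\<Sum>j<n. if j = i then v j else 0)"
    by (intro sum.cong) (auto simp: unit_vec_apply)
  then show "v i = (\<Sum>j<n. smul (v j) (unit_vec j)) i"
    using assms by (simp add: fvec_def)
qed

lemma linear_map_expansion:
  assumes "linear_map A" "v \<in> fvec n"
  shows "A v = (\<Sum>j<n. smul (v j) (A (unit_vec j)))"
proof -
  interpret module_hom smul smul A
    by fact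
  have "A v = A (\<Sum>j<n. smul (v j) (unit_vec j))"
    using fvec_expansion[OF assms(2)] by simp
  then show ?thesis
    by (simp add: sum scale)
qed

text \<open>For \<open>f\<close> outside \<open>M\<close> this is a base change that is invertible
  over \<open>R_M\<close>, with inverse \<open>P' / f\<close>. The two composition identities hold
  on all sequences, so they rewrite without membership conditions.\<close>

definition quasi_inverse ::
  "nat \<Rightarrow> 'a::comm_ring_1 \<Rightarrow> ((nat \<Rightarrow> 'a) \<Rightarrow> nat \<Rightarrow> 'a) \<Rightarrow> ((nat \<Rightarrow> 'a) \<Rightarrow> nat \<Rightarrow> 'a) \<Rightarrow> bool" where
  "quasi_inverse n f P P' \<longleftrightarrow> linear_map P \<and> linear_map P' \<and>
    (\<forall>v\<in>fvec n. P v \<in> fvec n) \<and> (\<forall>v\<in>fvec n. P' v \<in> fvec n) \<and>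
    (\<forall>v. P (P' v) = smul f v) \<and> (\<forall>v. P' (P v) = smul f v)"

section \<open>Elementary operations as quasi-inverse pairs\<close>

lemma quasi_inverse_id: "quasi_inverse n 1 (\<lambda>v. v) (\<lambda>v. v)"
  by (simp add: quasi_inverse_def vec.module_hom_ident)

lemma quasi_inverse_comp:
  assumes "quasi_inverse n f P P'" "quasi_inverse n g R R'"
  shows "quasi_inverse n (f * g) (\<lambda>v. P (R v)) (\<lambda>v. R' (P' v))"
proof -
  have "P (smul r v) = smul r (P v)" "R' (smul r v) = smul r (R' v)" for r v
    using assms module_hom.scale unfolding quasi_inverse_def by blast+
  then show ?thesis
    using assms by (simp add: quasi_inverse_def linear_map_comp mult.commute)
qed

lemma quasi_inverse_swap:
  assumes "a < n" "b < n"
  shows "quasi_inverse n 1 (\<lambda>v. v(a := v b, b := v a)) (\<lambda>v. v(a := v b, b := v a))"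
proof -
  have "linear_map (\<lambda>v. v(a := v b, b := v a))"
    by (rule linear_mapI) (auto simp: fun_eq_iff)
  then show ?thesis
    using assms by (auto simp: quasi_inverse_def fvec_def fun_eq_iff)
qed

text \<open>Subtracting \<open>z i / s\<close> times row \<open>t\<close> from each other row
  \<open>i\<close>, multiplied by \<open>s\<close> to clear the denominator.\<close>

lemma quasi_inverse_row:
  assumes "t < n" "\<And>i. i \<ge> n \<Longrightarrow> z i = 0"
  shows "quasi_inverse n s (\<lambda>v i. if i = t then v t else s * v i - z i * v t)
           (\<lambda>v i. if i = t then s * v t else v i + z i * v t)"
proof -
  have "linear_map (\<lambda>v i. if i = t then v t else s * v i - z i * v t)"
    "linear_map (\<lambda>v i. if i = t then s * v t else v i + z i * v t)"
    by (rule linear_mapI; auto simp: fun_eq_iff algebra_simps)+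
  then show ?thesis
    using assms by (auto simp: quasi_inverse_def fvec_def fun_eq_iff algebra_simps)
qed

text \<open>The first map fixes \<open>unit_vec t\<close> and sends any other
  \<open>unit_vec j\<close> with \<open>j < n\<close> to
  \<open>s * unit_vec j - z j * unit_vec t\<close>. As \<open>z t = 0\<close>, the sum does not see
  coordinate \<open>t\<close>, the only one it modifies.\<close>

lemma quasi_inverse_column:
  assumes "t < n" "z t = 0"
  shows "quasi_inverse n s (\<lambda>v i. if i = t then v t - (\<Sum>j<n. z j * v j) else s * v i)
           (\<lambda>v i. if i = t then s * v t + (\<Sum>j<n. z j * v j) else v i)"
    (is "quasi_inverse n s ?Q ?Q'")
proof -
  have lin: "linear_map ?Q" "linear_map ?Q'"
    by (rule linear_mapI; auto simp: fun_eq_iff algebra_simps sum.distrib sum_distrib_left)+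
  have "(\<Sum>j<n. z j * ?Q' v j) = (\<Sum>j<n. z j * v j)" for v
    using assms(2) by (intro sum.cong) auto
  then have QQ': "?Q (?Q' v) = smul s v" for v
    by (auto simp: fun_eq_iff)
  have "(\<Sum>j<n. z j * ?Q v j) = s * (\<Sum>j<n. z j * v j)" for v
    unfolding sum_distrib_left using assms(2) by (intro sum.cong) auto
  then have Q'Q: "?Q' (?Q v) = smul s v" for v
    by (auto simp: fun_eq_iff algebra_simps)
  show ?thesis
    unfolding quasi_inverse_def using lin QQ' Q'Q assms(1) by (auto simp: fvec_def)
qed

text \<open>State of the elimination after \<open>t\<close> pivots: a diagonal block of size
  \<open>t\<close> and an arbitrary block in rows and columns from \<open>t\<close> on.\<close>

definition partial_diagonal :: "nat \<Rightarrow> nat \<Rightarrow> nat \<Rightarrow> ((nat \<Rightarrow> 'a::comm_ring_1) \<Rightarrow> nat \<Rightarrow> 'a) \<Rightarrow> bool" where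
  "partial_diagonal p q t B \<longleftrightarrow>
     (\<forall>i<p. \<forall>j<q. i \<noteq> j \<longrightarrow> i < t \<or> j < t \<longrightarrow> B (unit_vec j) i = 0)"

section \<open>Gaussian elimination up to denominators\<close>

context valuation_at
begin

text \<open>Some entry of the remaining block divides the whole block up to \<open>s\<close>. A row
  swap and a column swap bring it to position \<open>(t, t)\<close>; they fix all indices below
  \<open>t\<close>, so the finished part is preserved.\<close>

lemma exists_pivot:
  assumes "t < p" "t < q" "partial_diagonal p q t B"
  obtains s P P' Q Q' where "s \<notin> M" "quasi_inverse p 1 P P'" "quasi_inverse q 1 Q Q'"
    "partial_diagonal p q t (\<lambda>v. P (B (Q v)))"
    "\<And>i j. i \<in> {t..<p} \<Longrightarrow> j \<in> {t..<q} \<Longrightarrow>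
       \<exists>z. s * P (B (Q (unit_vec j))) i = z * P (B (Q (unit_vec t))) t"
proof -
  let ?L = "{t..<p} \<times> {t..<q}"
  have "finite ?L" "?L \<noteq> {}"
    using assms by auto
  then have "\<exists>m\<in>?L. \<exists>s. s \<notin> M \<and> (\<forall>l\<in>?L. \<exists>z. s * B (unit_vec (snd l)) (fst l) = z * B (unit_vec (snd m)) (fst m))"
    by (rule exists_divisor_of_all)
  then obtain i0 j0 s where s: "s \<notin> M" and ij: "i0 \<in> {t..<p}" "j0 \<in> {t..<q}"
    and z: "\<And>i j. i \<in> {t..<p} \<Longrightarrow> j \<in> {t..<q} \<Longrightarrow> \<exists>z. s * B (unit_vec j) i = z * B (unit_vec j0) i0"
    by fastforce
  define P where "P = (\<lambda>v::nat \<Rightarrow> 'a. v(t := v i0, i0 := v t))"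
  define Q where "Q = (\<lambda>v::nat \<Rightarrow> 'a. v(t := v j0, j0 := v t))"
  define \<sigma> where "\<sigma> = id(t := i0, i0 := t)"
  define \<tau> where "\<tau> = id(t := j0, j0 := t)"
  have Q: "Q (unit_vec j) = unit_vec (\<tau> j)" for j
    by (auto simp: Q_def \<tau>_def fun_eq_iff unit_vec_apply)
  have P: "P v i = v (\<sigma> i)" for v i
    by (auto simp: P_def \<sigma>_def)
  have entry: "P (B (Q (unit_vec j))) i = B (unit_vec (\<tau> j)) (\<sigma> i)" for i j
    by (simp add: P Q)
  have \<sigma>: "\<sigma> i < p" "\<sigma> i < t \<longleftrightarrow> i < t" "i < t \<Longrightarrow> \<sigma> i = i" if "i < p" for i
    using that ij assms by (auto simp: \<sigma>_def split: if_splits)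
  have \<tau>: "\<tau> j < q" "\<tau> j < t \<longleftrightarrow> j < t" "j < t \<Longrightarrow> \<tau> j = j" if "j < q" for j
    using that ij assms by (auto simp: \<tau>_def split: if_splits)
  show thesis
  proof (rule that[OF s])
    show "quasi_inverse p 1 P P" "quasi_inverse q 1 Q Q"
      unfolding P_def Q_def using ij assms by (auto intro!: quasi_inverse_swap)
    show "partial_diagonal p q t (\<lambda>v. P (B (Q v)))"
      unfolding partial_diagonal_def
    proof (intro allI impI)
      fix i j assume *: "i < p" "j < q" "i \<noteq> j" "i < t \<or> j < t"
      then have "\<sigma> i \<noteq> \<tau> j"
        by (metis \<sigma>(2,3) \<tau>(2,3))
      then show "P (B (Q (unit_vec j))) i = 0"
        using assms(3) * \<sigma>(1,2)[of i] \<tau>(1,2)[of j] by (auto simp: entry partial_diagonal_def)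
    qed
    show "\<exists>z. s * P (B (Q (unit_vec j))) i = z * P (B (Q (unit_vec t))) t"
      if "i \<in> {t..<p}" "j \<in> {t..<q}" for i j
    proof -
      have "\<sigma> t = i0" "\<tau> t = j0" "\<sigma> i \<in> {t..<p}" "\<tau> j \<in> {t..<q}"
        using that ij \<sigma>(1,2)[of i] \<tau>(1,2)[of j] by (auto simp: \<sigma>_def \<tau>_def)
      then show ?thesis
        using z[of "\<sigma> i" "\<tau> j"] by (simp add: entry)
    qed
  qed
qed

text \<open>Since the pivot divides its row and column up to \<open>s\<close>, the quotients serve
  as multipliers: \<open>Q\<close> clears row \<open>t\<close> and \<open>P\<close> clears column
  \<open>t\<close>.\<close>

lemma eliminate_pivot:
  assumes B: "linear_map B" "partial_diagonal p q t B" "t < p" "t < q" and s: "s \<notin> M"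
    and div: "\<And>i j. i \<in> {t..<p} \<Longrightarrow> j \<in> {t..<q} \<Longrightarrow> \<exists>z. s * B (unit_vec j) i = z * B (unit_vec t) t"
  obtains P P' Q Q' where "quasi_inverse p s P P'" "quasi_inverse q s Q Q'"
    "partial_diagonal p q (Suc t) (\<lambda>v. P (B (Q v)))"
proof -
  have "\<forall>i. \<exists>z. i \<in> {t<..<p} \<longrightarrow> s * B (unit_vec t) i = z * B (unit_vec t) t"
    using div[of _ t] assms(4) by fastforce
  then obtain y0 where y0: "\<And>i. i \<in> {t<..<p} \<Longrightarrow> s * B (unit_vec t) i = y0 i * B (unit_vec t) t"
    by metis
  have "\<forall>j. \<exists>z. j \<in> {t<..<q} \<longrightarrow> s * B (unit_vec j) t = z * B (unit_vec t) t"
    using div[of t] assms(3) by fastforce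
  then obtain z0 where z0: "\<And>j. j \<in> {t<..<q} \<Longrightarrow> s * B (unit_vec j) t = z0 j * B (unit_vec t) t"
    by metis
  \<comment> \<open>The multipliers are zero up to index \<open>t\<close> and beyond the matrix:
    earlier rows and columns are only rescaled, and \<open>P\<close> and \<open>Q\<close> preserve
    \<open>fvec\<close>.\<close>
  define y where "y = (\<lambda>i. if i \<in> {t<..<p} then y0 i else 0)"
  define z where "z = (\<lambda>j. if j \<in> {t<..<q} then z0 j else 0)"
  define P where "P = (\<lambda>(v::nat \<Rightarrow> 'a) i. if i = t then v t else s * v i - y i * v t)"
  define Q where "Q = (\<lambda>(v::nat \<Rightarrow> 'a) i. if i = t then v t - (\<Sum>j<q. z j * v j) else s * v i)"
  have zero: "B (unit_vec j) i = 0" if "i < p" "j < q" "i \<noteq> j" "i < t \<or> j < t" for i j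
    using B(2) that by (auto simp: partial_diagonal_def)
  have qP: "\<exists>P'. quasi_inverse p s P P'"
    unfolding P_def using quasi_inverse_row[OF assms(3), of y s] by (auto simp: y_def)
  have qQ: "\<exists>Q'. quasi_inverse q s Q Q'"
    unfolding Q_def using quasi_inverse_column[OF assms(4), of z s] by (auto simp: z_def)
  have Qt: "Q (unit_vec t) = unit_vec t"
  proof -
    have "(\<Sum>j<q. z j * unit_vec t j) = 0"
      by (intro sum.neutral) (auto simp: unit_vec_apply z_def)
    then show ?thesis
      by (auto simp: Q_def fun_eq_iff unit_vec_apply)
  qed
  have Qj: "Q (unit_vec j) = smul s (unit_vec j) - smul (z j) (unit_vec t)" if "j < q" "j \<noteq> t" for j
  proof -
    have "(\<Sum>l<q. z l * unit_vec j l) = (\<Sum>l<q. if l = j then z l else 0)"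
      by (intro sum.cong) (auto simp: unit_vec_apply)
    then have "(\<Sum>l<q. z l * unit_vec j l) = z j"
      using that by simp
    then show ?thesis
      using that by (auto simp: Q_def fun_eq_iff unit_vec_apply)
  qed
  have Bj: "B (Q (unit_vec j)) i = s * B (unit_vec j) i - z j * B (unit_vec t) i"
    if "j < q" "j \<noteq> t" for i j
    using B(1) that by (simp add: Qj module_hom.diff[of smul smul B] module_hom.scale[of smul smul B])
  have "partial_diagonal p q (Suc t) (\<lambda>v. P (B (Q v)))"
    unfolding partial_diagonal_def
  proof (intro allI impI)
    fix i j assume *: "i < p" "j < q" "i \<noteq> j" "i < Suc t \<or> j < Suc t"
    \<comment> \<open>Once row \<open>t\<close> of \<open>B Q\<close> vanishes off the pivot,
      subtracting multiples of it under \<open>P\<close> changes no column other than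
      \<open>t\<close>.\<close>
    have row: "B (Q (unit_vec j)) t = 0" if "j \<noteq> t"
    proof (cases "j < t")
      case True
      then show ?thesis
        using Bj[of j t] * that zero[of t j] assms(3) by (simp add: z_def)
    next
      case False
      then show ?thesis
        using Bj[of j t] * that z0[of j] by (simp add: z_def)
    qed
    have col: "P (B (unit_vec t)) i = 0" if "i \<noteq> t"
    proof (cases "i < t")
      case True
      then show ?thesis
        using zero[of i t] * assms(4) by (simp add: P_def y_def)
    next
      case False
      then show ?thesis
        using that * y0[of i] by (simp add: P_def y_def)
    qed
    show "P (B (Q (unit_vec j))) i = 0"
    proof (cases "j = t")
      case True
      then show ?thesis
        using col * Qt by simp
    next
      case False
      show ?thesis
      proof (cases "i = t")
        case True
        then show ?thesis
          using row[OF False] by (simp add: P_def)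
      next
        case i: False
        have "B (unit_vec j) i = 0" "z j * B (unit_vec t) i = 0"
          using zero[of i j] zero[of i t] * False i assms(4) by (auto simp: z_def)
        then show ?thesis
          using row[OF False] i Bj[OF *(2) False, of i] by (simp add: P_def)
      qed
    qed
  qed
  with qP qQ that show thesis
    by blast
qed

text \<open>Each round moves a pivot into place and eliminates with it; the factors of the composed
  quasi-inverses multiply and stay outside \<open>M\<close>.\<close>

lemma exists_partial_diagonal:
  assumes A: "linear_map A" and "t \<le> p" "t \<le> q"
  shows "\<exists>f P P' g Q Q'. f \<notin> M \<and> g \<notin> M \<and> quasi_inverse p f P P' \<and> quasi_inverse q g Q Q' \<and>
           partial_diagonal p q t (\<lambda>v. P (A (Q v)))"
  using assms(2,3)
proof (induction t)
  case 0
  have "partial_diagonal p q 0 (\<lambda>v. A v)"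
    by (simp add: partial_diagonal_def)
  then show ?case
    using one_notin quasi_inverse_id by blast
next
  case (Suc t)
  then have "t \<le> p" "t \<le> q" and t: "t < p" "t < q"
    by auto
  with Suc.IH obtain f P P' g Q Q' where fg: "f \<notin> M" "g \<notin> M"
    and PQ: "quasi_inverse p f P P'" "quasi_inverse q g Q Q'"
    and diag: "partial_diagonal p q t (\<lambda>v. P (A (Q v)))"
    by blast
  obtain s P1 P1' Q1 Q1' where s: "s \<notin> M" and PQ1: "quasi_inverse p 1 P1 P1'" "quasi_inverse q 1 Q1 Q1'"
    and diag1: "partial_diagonal p q t (\<lambda>v. P1 (P (A (Q (Q1 v)))))"
    and div: "\<And>i j. i \<in> {t..<p} \<Longrightarrow> j \<in> {t..<q} \<Longrightarrow>
       \<exists>z. s * P1 (P (A (Q (Q1 (unit_vec j))))) i = z * P1 (P (A (Q (Q1 (unit_vec t))))) t"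
    by (rule exists_pivot[OF t diag]) blast
  have "linear_map P" "linear_map P1" "linear_map Q" "linear_map Q1"
    using PQ PQ1 by (simp_all add: quasi_inverse_def)
  then have "linear_map (\<lambda>v. P1 (P (A (Q (Q1 v)))))"
    using linear_map_comp[of P1 "\<lambda>v. P (A (Q (Q1 v)))"] linear_map_comp[of P "\<lambda>v. A (Q (Q1 v))"]
      linear_map_comp[OF A, of "\<lambda>v. Q (Q1 v)"] linear_map_comp[of Q Q1] by blast
  then obtain P2 P2' Q2 Q2' where PQ2: "quasi_inverse p s P2 P2'" "quasi_inverse q s Q2 Q2'"
    and diag2: "partial_diagonal p q (Suc t) (\<lambda>v. P2 (P1 (P (A (Q (Q1 (Q2 v)))))))"
    using eliminate_pivot[OF _ diag1 t s div] by blast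
  have "s * (1 * f) \<notin> M" "(g * 1) * s \<notin> M"
    using s fg mult_notin by simp_all
  with diag2 quasi_inverse_comp[OF PQ2(1) quasi_inverse_comp[OF PQ1(1) PQ(1)]]
    quasi_inverse_comp[OF quasi_inverse_comp[OF PQ(2) PQ1(2)] PQ2(2)]
  show ?case
    by blast
qed

text \<open>At an off-diagonal position of a \<open>p\<close> by \<open>q\<close> matrix the smaller
  index is below \<open>min p q\<close>, so that many rounds finish the elimination. Columns in
  excess of the rows get \<open>b i = 0\<close>.\<close>

lemma diagonalization:
  assumes A: "linear_map A" "\<And>v. v \<in> fvec q \<Longrightarrow> A v \<in> fvec p"
  obtains f g P P' Q Q' b where "f \<notin> M" "g \<notin> M" "quasi_inverse p f P P'" "quasi_inverse q g Q Q'"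
    "\<forall>v\<in>fvec q. P (A (Q v)) = (\<lambda>i. b i * v i)" "\<forall>i\<ge>p. b i = 0"
proof -
  obtain f P P' g Q Q' where fg: "f \<notin> M" "g \<notin> M"
    and PQ: "quasi_inverse p f P P'" "quasi_inverse q g Q Q'"
    and diag: "partial_diagonal p q (min p q) (\<lambda>v. P (A (Q v)))"
    using exists_partial_diagonal[OF A(1), of "min p q" p q] by auto
  define b where "b = (\<lambda>j. if j < q then P (A (Q (unit_vec j))) j else 0)"
  have mem: "P (A (Q v)) \<in> fvec p" if "v \<in> fvec q" for v
    using PQ A(2) that by (simp add: quasi_inverse_def)
  have lin: "linear_map (\<lambda>v. P (A (Q v)))"
    using linear_map_comp[of P "\<lambda>v. A (Q v)"] linear_map_comp[OF A(1), of Q] PQ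
    by (simp add: quasi_inverse_def)
  have unit: "P (A (Q (unit_vec j))) = smul (b j) (unit_vec j)" if "j < q" for j
  proof
    fix i
    show "P (A (Q (unit_vec j))) i = smul (b j) (unit_vec j) i"
    proof (cases "i = j \<or> i \<ge> p")
      case True
      then show ?thesis
        using mem[of "unit_vec j"] that by (auto simp: b_def unit_vec_apply fvec_def)
    next
      case False
      then have "i < p" "i \<noteq> j" "i < min p q \<or> j < min p q"
        using that by auto
      then show ?thesis
        using diag that unfolding partial_diagonal_def by (auto simp: unit_vec_apply)
    qed
  qed
  have b: "P (A (Q v)) = (\<lambda>i. b i * v i)" if v: "v \<in> fvec q" for v
  proof
    fix i
    have "P (A (Q v)) = (\<Sum>j<q. smul (v j) (smul (b j) (unit_vec j)))"
      unfolding linear_map_expansion[OF lin v] using unit by (intro sum.cong) auto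
    then have "P (A (Q v)) i = (\<Sum>j<q. v j * (b j * unit_vec j i))"
      by (simp add: mult.assoc)
    also have "\<dots> = (\<Sum>j<q. if j = i then b j * v j else 0)"
      by (intro sum.cong) (auto simp: unit_vec_apply)
    also have "\<dots> = b i * v i"
      using v by (simp add: fvec_def)
    finally show "P (A (Q v)) i = b i * v i" .
  qed
  have "b i = 0" if "i \<ge> p" for i
    using mem[OF unit_vec_in_fvec[of i q]] that by (auto simp: b_def fvec_def)
  then show thesis
    using that fg PQ b by blast
qed

end

section \<open>Finite generation of syzygies\<close>

lemma quasi_inverseD:
  assumes "quasi_inverse n f P P'"
  shows "linear_map P" "linear_map P'" "v \<in> fvec n \<Longrightarrow> P v \<in> fvec n" "v \<in> fvec n \<Longrightarrow> P' v \<in> fvec n"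
    "P (P' v) = smul f v" "P' (P v) = smul f v"
  using assms by (auto simp: quasi_inverse_def)

lemma smul_in_fvec [simp]: "v \<in> fvec n \<Longrightarrow> smul r v \<in> fvec n"
  by (simp add: fvec_def)

lemma subspace_kernel:
  assumes "linear_map A"
  shows "vec.subspace {v \<in> fvec n. A v = 0}"
proof -
  have "{v \<in> fvec n. A v = 0} = fvec n \<inter> {v. A v = 0}"
    by blast
  then show ?thesis
    using vec.subspace_inter[OF subspace_fvec module_hom.subspace_kernel[OF assms]] by simp
qed

text \<open>A diagonalization \<open>P A\<^sub>2 Q\<close> of the middle map of an exact sequence exhibits
  \<open>R b\<^sub>i\<close>, up to a factor, as the annihilator of the vector \<open>A\<^sub>1 P' e\<^sub>i\<close>.\<close>

lemma diagonal_entry_annihilator: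
  assumes A1: "linear_map A1" and A2: "linear_map A2"
    and ex: "{v \<in> fvec p. A1 v = 0} = A2 ` fvec q"
    and P: "quasi_inverse p f P P'" and Q: "quasi_inverse q g Q Q'"
    and diag: "\<forall>v\<in>fvec q. P (A2 (Q v)) = (\<lambda>i. b i * v i)"
    and i: "i < p" "i < q"
  shows "smul (b i) (A1 (P' (unit_vec i))) = 0"
    and "smul r (A1 (P' (unit_vec i))) = 0 \<Longrightarrow> \<exists>z. f * g * r = z * b i"
proof -
  interpret A1: module_hom smul smul A1 by fact
  interpret A2: module_hom smul smul A2 by fact
  interpret P: module_hom smul smul P by (rule quasi_inverseD[OF P])
  interpret P': module_hom smul smul P' by (rule quasi_inverseD[OF P])
  \<comment> \<open>Applying \<open>A1 P'\<close> to this identity turns \<open>P' P\<close> into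
    the factor \<open>f\<close> and leaves \<open>A1 A2\<close>, which is zero by exactness.\<close>
  have "smul (b i) (unit_vec i) = P (A2 (Q (unit_vec i)))"
    using bspec[OF diag, of "unit_vec i"] i by (auto simp: fun_eq_iff unit_vec_apply)
  then have "A1 (P' (smul (b i) (unit_vec i))) = A1 (P' (P (A2 (Q (unit_vec i)))))"
    by (simp only:)
  then have "smul (b i) (A1 (P' (unit_vec i))) = smul f (A1 (A2 (Q (unit_vec i))))"
    by (simp only: quasi_inverseD(6)[OF P] A1.scale P'.scale)
  moreover have "A1 (A2 (Q (unit_vec i))) = 0"
    using ex quasi_inverseD(3)[OF Q, of "unit_vec i"] i by auto
  ultimately show "smul (b i) (A1 (P' (unit_vec i))) = 0"
    by simp
  assume "smul r (A1 (P' (unit_vec i))) = 0"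
  then have "A1 (smul r (P' (unit_vec i))) = 0"
    by (simp add: A1.scale)
  then have "smul r (P' (unit_vec i)) \<in> A2 ` fvec q"
    using ex i quasi_inverseD(4)[OF P, of "unit_vec i"] by auto
  then obtain x where x: "x \<in> fvec q" "smul r (P' (unit_vec i)) = A2 x"
    by blast
  \<comment> \<open>Coordinate \<open>i\<close> of \<open>P A2 Q Q' x\<close> is computed twice: the
    diagonal form gives \<open>b i * Q' x i\<close>, cancelling the quasi-inverses gives
    \<open>g * r * f\<close>.\<close>
  have "b i * Q' x i = P (A2 (Q (Q' x))) i"
    using bspec[OF diag, of "Q' x"] quasi_inverseD(4)[OF Q x(1)] by simp
  moreover have "P (A2 (Q (Q' x))) = smul g (P (A2 x))"
    by (simp only: quasi_inverseD(5)[OF Q] A2.scale P.scale)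
  moreover have "P (A2 x) = smul r (smul f (unit_vec i))"
    by (simp only: P.scale quasi_inverseD(5)[OF P] flip: x(2))
  ultimately have "b i * Q' x i = g * (r * f)"
    by (simp add: unit_vec_apply)
  then have "f * g * r = Q' x i * b i"
    by (simp add: ac_simps)
  then show "\<exists>z. f * g * r = z * b i"
    by blast
qed

text \<open>\<open>Q\<close> and \<open>Q'\<close> carry the solutions of
  \<open>b i * v i = 0\<close> to the kernel of \<open>A2\<close> and back. The first direction
  costs \<open>f\<close>, since \<open>P'\<close> cancels \<open>P\<close> only up to that
  factor.\<close>

lemma diagonal_kernel:
  assumes A2: "linear_map A2" and P: "quasi_inverse p f P P'" and Q: "quasi_inverse q g Q Q'"
    and diag: "\<forall>v\<in>fvec q. P (A2 (Q v)) = (\<lambda>i. b i * v i)"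
  shows "v \<in> fvec q \<Longrightarrow> (\<And>i. b i * v i = 0) \<Longrightarrow> A2 (Q (smul f v)) = 0"
    and "h \<in> fvec q \<Longrightarrow> A2 h = 0 \<Longrightarrow> b i * Q' h i = 0"
proof -
  interpret A2: module_hom smul smul A2 by fact
  interpret P: module_hom smul smul P by (rule quasi_inverseD[OF P])
  interpret P': module_hom smul smul P' by (rule quasi_inverseD[OF P])
  interpret Q: module_hom smul smul Q by (rule quasi_inverseD[OF Q])
  show "A2 (Q (smul f v)) = 0" if v: "v \<in> fvec q" "\<And>i. b i * v i = 0"
  proof -
    have "A2 (Q (smul f v)) = P' (P (A2 (Q v)))"
      by (simp only: quasi_inverseD(6)[OF P] A2.scale Q.scale)
    moreover have "P (A2 (Q v)) = 0"
      using bspec[OF diag v(1)] v(2) by (simp add: fun_eq_iff)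
    ultimately show ?thesis
      by simp
  qed
  show "b i * Q' h i = 0" if h: "h \<in> fvec q" "A2 h = 0"
  proof -
    have "b i * Q' h i = P (A2 (Q (Q' h))) i"
      using bspec[OF diag, of "Q' h"] quasi_inverseD(4)[OF Q h(1)] by simp
    then show ?thesis
      by (simp add: quasi_inverseD(5)[OF Q] A2.scale h(2))
  qed
qed

section \<open>Local generators for the kernels\<close>

context valuation_at
begin

text \<open>The pair \<open>f\<close>, \<open>S\<close> says without localizing that
  \<open>S\<close> generates the kernel of \<open>A3\<close> at \<open>M\<close>. With
  \<open>x i\<close> a lift along \<open>A3\<close> of the transported vector
  \<open>c i * e_i\<close>, the set \<open>S\<close> consists of the \<open>b i * x i\<close> and of
  vectors \<open>t l\<close> that express the basis vectors through the \<open>x i\<close>.\<close>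

lemma third_syzygy_locally_fg:
  assumes A1: "linear_map A1" and A2: "linear_map A2" and A3: "linear_map A3"
    and ex1: "{v \<in> fvec p. A1 v = 0} = A2 ` fvec q"
    and ex2: "{v \<in> fvec q. A2 v = 0} = A3 ` fvec r"
  shows "\<exists>f S. f \<notin> M \<and> finite S \<and> S \<subseteq> {v \<in> fvec r. A3 v = 0} \<and>
           (\<forall>y\<in>{v \<in> fvec r. A3 v = 0}. smul f y \<in> vec.span S)"
proof -
  have A2_mem: "A2 v \<in> fvec p" if "v \<in> fvec q" for v
    using ex1 that by blast
  obtain f g P P' Q Q' b where fg: "f \<notin> M" "g \<notin> M"
    and P: "quasi_inverse p f P P'" and Q: "quasi_inverse q g Q Q'"
    and diag: "\<forall>v\<in>fvec q. P (A2 (Q v)) = (\<lambda>i. b i * v i)" and bp: "\<forall>i\<ge>p. b i = 0"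
    by (rule diagonalization[OF A2 A2_mem])
  interpret A3: module_hom smul smul A3 by fact
  interpret Q: module_hom smul smul Q by (rule quasi_inverseD[OF Q])
  interpret Q': module_hom smul smul Q' by (rule quasi_inverseD[OF Q])
  note ker = diagonal_kernel[OF A2 P Q diag]
  have A3_mem: "A3 y \<in> fvec q" "A2 (A3 y) = 0" if "y \<in> fvec r" for y
    using ex2 that by auto
  \<comment> \<open>Exactness at the source of \<open>A2\<close> lifts every diagonal solution,
    scaled by \<open>f\<close> and transported by \<open>Q\<close>.\<close>
  have lift: "\<exists>y\<in>fvec r. A3 y = Q (smul f v)" if v: "v \<in> fvec q" "\<And>i. b i * v i = 0" for v
  proof -
    have "Q (smul f v) \<in> fvec q"
      using quasi_inverseD(3)[OF Q, of "smul f v"] v(1) by simp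
    then have "Q (smul f v) \<in> A3 ` fvec r"
      using ex2 ker(1)[OF v] by blast
    then show ?thesis
      by (metis imageE)
  qed
  \<comment> \<open>The columns of \<open>A3\<close> in the coordinates of the diagonal
    form.\<close>
  define C where "C = (\<lambda>l. Q' (A3 (unit_vec l)))"
  have C_mem: "C l \<in> fvec q" if "l < r" for l
    unfolding C_def using A3_mem(1)[of "unit_vec l"] that quasi_inverseD(4)[OF Q] by simp
  have bC: "b i * C l i = 0" if "l < r" for l i
    unfolding C_def using A3_mem[of "unit_vec l"] that ker(2) by simp
  have Q'A3: "Q' (A3 y) i = (\<Sum>l<r. y l * C l i)" if "y \<in> fvec r" for y i
    by (simp add: linear_map_expansion[OF A3 that] Q'.sum Q'.scale C_def)
  \<comment> \<open>Up to \<open>s\<close>, the element \<open>c\<close> generates the annihilator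
    of \<open>b i\<close> as seen by the columns, and \<open>b i\<close> generates the annihilator
    of \<open>c\<close>.\<close>
  have local: "\<exists>s. s \<notin> M \<and> (\<exists>c. b i * c = 0 \<and> (\<forall>l<r. \<exists>z. s * C l i = z * c) \<and>
      (\<forall>w. w * c = 0 \<longrightarrow> (\<exists>z. s * w = z * b i)))" if i: "i < q" for i
  proof (cases "i < p")
    case False
    then have "b i = 0"
      using bp by simp
    \<comment> \<open>Beyond the rows \<open>s = c = 1\<close> works, since everything annihilates
      \<open>b i = 0\<close> and only \<open>0\<close> annihilates \<open>1\<close>.\<close>
    then show ?thesis
      using one_notin by (intro exI[of _ 1] conjI) auto
  next
    case True
    note ann = diagonal_entry_annihilator[OF A1 A2 ex1 P Q diag True i]
    \<comment> \<open>Take for \<open>c\<close> an entry \<open>C m i\<close> that divides all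
      \<open>C l i\<close> at \<open>M\<close>, and \<open>c = 0\<close> when there are no
      columns.\<close>
    have "\<exists>s c. s \<notin> M \<and> b i * c = 0 \<and> (\<forall>l<r. \<exists>z. s * C l i = z * c)"
    proof (cases "r = 0")
      case True
      then show ?thesis
        using one_notin by (intro exI[of _ 1] exI[of _ 0]) auto
    next
      case False
      then have "\<exists>m\<in>{..<r}. \<exists>s. s \<notin> M \<and> (\<forall>l\<in>{..<r}. \<exists>z. s * C l i = z * C m i)"
        by (intro exists_divisor_of_all) auto
      then show ?thesis
        using bC by (metis lessThan_iff)
    qed
    then obtain s c where s: "s \<notin> M" and c: "b i * c = 0" and dv: "\<forall>l<r. \<exists>z. s * C l i = z * c"
      by blast
    then obtain z where z: "\<And>l. l < r \<Longrightarrow> s * C l i = z l * c"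
      by metis
    \<comment> \<open>The vector \<open>x * e_i\<close> lifts to some \<open>y\<close>; coordinate
      \<open>i\<close> of \<open>Q' A3 y\<close> is a combination of the \<open>C l i\<close>, hence
      a multiple of \<open>c\<close> up to \<open>s\<close>.\<close>
    have ann_b: "\<exists>z. s * (f * g) * x = z * c" if x: "b i * x = 0" for x
    proof -
      have "smul x (unit_vec i) \<in> fvec q" "\<And>k. b k * smul x (unit_vec i) k = 0"
        using i x by (auto simp: unit_vec_apply)
      then obtain y where y: "y \<in> fvec r" "A3 y = Q (smul f (smul x (unit_vec i)))"
        using lift by blast
      have "Q' (A3 y) i = g * (f * x)"
        unfolding y(2) quasi_inverseD(6)[OF Q] by (simp add: unit_vec_apply)
      then have "s * (f * g) * x = s * (\<Sum>l<r. y l * C l i)"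
        using Q'A3[OF y(1), of i] by (simp add: ac_simps)
      also have "\<dots> = (\<Sum>l<r. y l * (s * C l i))"
        by (simp add: sum_distrib_left ac_simps)
      also have "\<dots> = (\<Sum>l<r. y l * z l) * c"
        unfolding sum_distrib_right by (intro sum.cong) (simp_all add: z mult.assoc)
      finally show ?thesis
        by blast
    qed
    let ?V = "A1 (P' (unit_vec i))"
    \<comment> \<open>One factor \<open>s * (f * g)\<close> is spent in \<open>ann_b\<close>, the
      other \<open>f * g\<close> in \<open>ann(2)\<close>.\<close>
    let ?s = "(f * g) * ((f * g) * s)"
    have "?s \<notin> M"
      using s fg mult_notin by simp
    moreover have "\<exists>z. ?s * C l i = z * c" if "l < r" for l
    proof -
      have "?s * C l i = (f * g) * (f * g) * (s * C l i)"
        by (simp only: ac_simps)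
      also have "\<dots> = ((f * g) * (f * g) * z l) * c"
        using z[OF that] by (simp only: ac_simps)
      finally show ?thesis
        by blast
    qed
    \<comment> \<open>Triple annihilator argument: \<open>b i\<close> kills the coordinates of
      \<open>?V\<close>, so these are multiples of \<open>c\<close> up to a factor; a
      \<open>w\<close> killing \<open>c\<close> therefore kills a multiple of \<open>?V\<close> and
      falls into \<open>R b i\<close>.\<close>
    moreover have "\<exists>z. ?s * w = z * b i" if w: "w * c = 0" for w
    proof -
      have "(w * (s * (f * g))) * ?V k = 0" for k
      proof -
        have "b i * ?V k = 0"
          using ann(1) by (simp add: fun_eq_iff)
        then obtain z where z: "s * (f * g) * ?V k = z * c"
          using ann_b by blast
        have "(w * (s * (f * g))) * ?V k = w * (s * (f * g) * ?V k)"
          by (simp only: ac_simps)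
        also have "\<dots> = z * (w * c)"
          unfolding z by (simp only: ac_simps)
        finally show ?thesis
          by (simp add: w)
      qed
      then have "smul (w * (s * (f * g))) ?V = 0"
        by (simp add: fun_eq_iff)
      then obtain z where "f * g * (w * (s * (f * g))) = z * b i"
        using ann(2) by blast
      then have "?s * w = z * b i"
        by (simp add: ac_simps)
      then show ?thesis
        by blast
    qed
    ultimately show ?thesis
      using c by blast
  qed
  have "\<exists>s. s \<notin> M \<and> (\<forall>i\<in>{..<q}. \<exists>c. b i * c = 0 \<and> (\<forall>l<r. \<exists>z. s * C l i = z * c) \<and>
      (\<forall>w. w * c = 0 \<longrightarrow> (\<exists>z. s * w = z * b i)))"
  proof (rule exists_common_multiplier)
    fix i s t
    assume "\<exists>c. b i * c = 0 \<and> (\<forall>l<r. \<exists>z. s * C l i = z * c) \<and> (\<forall>w. w * c = 0 \<longrightarrow> (\<exists>z. s * w = z * b i))"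
    then obtain c where c: "b i * c = 0" "\<forall>l<r. \<exists>z. s * C l i = z * c"
      "\<forall>w. w * c = 0 \<longrightarrow> (\<exists>z. s * w = z * b i)"
      by blast
    have mult: "\<exists>z. t * s * x = z * y" if "\<exists>z. s * x = z * y" for x y
      using that by (metis mult.assoc)
    show "\<exists>c. b i * c = 0 \<and> (\<forall>l<r. \<exists>z. t * s * C l i = z * c) \<and>
        (\<forall>w. w * c = 0 \<longrightarrow> (\<exists>z. t * s * w = z * b i))"
      by (rule exI[of _ c]) (use c mult in simp)
  qed (use local in auto)
  then obtain \<sigma> where \<sigma>: "\<sigma> \<notin> M" and "\<forall>i\<in>{..<q}. \<exists>c. b i * c = 0 \<and> (\<forall>l<r. \<exists>z. \<sigma> * C l i = z * c) \<and>
      (\<forall>w. w * c = 0 \<longrightarrow> (\<exists>z. \<sigma> * w = z * b i))"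
    by blast
  then obtain c where bc: "\<And>i. i < q \<Longrightarrow> b i * c i = 0"
    and Cc: "\<And>i. i < q \<Longrightarrow> \<forall>l<r. \<exists>z. \<sigma> * C l i = z * c i"
    and ann_c: "\<And>i w. i < q \<Longrightarrow> w * c i = 0 \<Longrightarrow> \<exists>z. \<sigma> * w = z * b i"
    unfolding Ball_def lessThan_iff by metis
  from Cc have "\<forall>l i. \<exists>z. i < q \<longrightarrow> l < r \<longrightarrow> \<sigma> * C l i = z * c i"
    by blast
  then obtain z where z: "\<And>l i. i < q \<Longrightarrow> l < r \<Longrightarrow> \<sigma> * C l i = z l i * c i"
    by metis
  have "\<forall>i. \<exists>x. i < q \<longrightarrow> x \<in> fvec r \<and> A3 x = Q (smul f (smul (c i) (unit_vec i)))"
  proof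
    fix i
    show "\<exists>x. i < q \<longrightarrow> x \<in> fvec r \<and> A3 x = Q (smul f (smul (c i) (unit_vec i)))"
    proof (cases "i < q")
      case True
      then have "smul (c i) (unit_vec i) \<in> fvec q" "\<And>k. b k * smul (c i) (unit_vec i) k = 0"
        using bc by (auto simp: unit_vec_apply)
      then show ?thesis
        using lift by blast
    qed blast
  qed
  then obtain x where x: "\<And>i. i < q \<Longrightarrow> x i \<in> fvec r"
    and A3x: "\<And>i. i < q \<Longrightarrow> A3 (x i) = Q (smul f (smul (c i) (unit_vec i)))"
    by metis
  have A3_sum: "A3 (\<Sum>i<q. smul (w i) (x i)) = Q (smul f (\<Sum>i<q. smul (w i * c i) (unit_vec i)))" for w
    by (simp add: A3.sum A3.scale A3x Q.scale Q.sum vec.scale_sum_right ac_simps)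
  \<comment> \<open>\<open>f\<close> comes from the lifts \<open>x i\<close>,
    \<open>\<sigma>\<close> from dividing \<open>C l i\<close> by \<open>c i\<close>, and
    \<open>g\<close> from cancelling \<open>Q Q'\<close>; with this factor
    \<open>A3 (t l) = 0\<close>.\<close>
  define \<kappa> where "\<kappa> = f * \<sigma> * g"
  define t where "t = (\<lambda>l. smul \<kappa> (unit_vec l) - (\<Sum>i<q. smul (z l i) (x i)))"
  define S where "S = t ` {..<r} \<union> (\<lambda>i. smul (b i) (x i)) ` {..<q}"
  have A3t: "A3 (t l) = 0" if l: "l < r" for l
  proof -
    have "(\<Sum>i<q. smul (z l i * c i) (unit_vec i)) = (\<Sum>i<q. smul (smul \<sigma> (C l) i) (unit_vec i))"
      using z[OF _ l] by (intro sum.cong) auto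
    also have "\<dots> = smul \<sigma> (C l)"
      by (rule fvec_expansion[OF smul_in_fvec[OF C_mem[OF l]], symmetric])
    finally have "A3 (\<Sum>i<q. smul (z l i) (x i)) = smul \<kappa> (A3 (unit_vec l))"
      by (simp add: A3_sum Q.scale C_def quasi_inverseD(5)[OF Q] \<kappa>_def ac_simps)
    then show ?thesis
      by (simp add: t_def A3.diff A3.scale)
  qed
  have t_mem: "t l \<in> fvec r" if "l < r" for l
    unfolding t_def using x that
    by (intro vec.subspace_diff[OF subspace_fvec] vec.subspace_sum[OF subspace_fvec]) auto
  have A3bx: "A3 (smul (b i) (x i)) = 0" if i: "i < q" for i
  proof -
    have "A3 (smul (b i) (x i)) = Q (smul (f * (b i * c i)) (unit_vec i))"
      by (simp add: A3.scale A3x[OF i] Q.scale ac_simps)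
    then show ?thesis
      by (simp add: bc[OF i])
  qed
  have "S \<subseteq> {v \<in> fvec r. A3 v = 0}"
    using A3t t_mem A3bx x by (auto simp: S_def)
  moreover have "smul (\<sigma> * (g * f) * \<kappa>) y \<in> vec.span S" if y: "y \<in> fvec r" "A3 y = 0" for y
  proof -
    \<comment> \<open>Modulo the \<open>t l\<close>, the vector \<open>\<kappa> y\<close> is the sum
      of the \<open>w i * x i\<close>. Applying \<open>A3\<close> and then \<open>Q'\<close> gives
      \<open>g * f * w i * c i = 0\<close>, so \<open>\<sigma> * g * f * w i\<close> is a multiple
      of \<open>b i\<close> and the rest lies in the span of the \<open>b i * x i\<close>.\<close>
    define w where "w = (\<lambda>i. \<Sum>l<r. y l * z l i)"
    have e1: "(\<Sum>l<r. smul (y l) (t l)) = smul \<kappa> (\<Sum>l<r. smul (y l) (unit_vec l)) -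
        (\<Sum>l<r. \<Sum>i<q. smul (y l * z l i) (x i))"
      by (simp add: t_def vec.scale_right_diff_distrib sum_subtractf vec.scale_sum_right mult.commute)
    have e2: "(\<Sum>l<r. \<Sum>i<q. smul (y l * z l i) (x i)) = (\<Sum>i<q. smul (w i) (x i))"
      unfolding w_def vec.scale_sum_left by (rule sum.swap)
    have e3: "smul \<kappa> y = smul \<kappa> (\<Sum>l<r. smul (y l) (unit_vec l))"
      by (rule arg_cong[OF fvec_expansion[OF y(1)]])
    have dec: "smul \<kappa> y = (\<Sum>l<r. smul (y l) (t l)) + (\<Sum>i<q. smul (w i) (x i))"
      by (simp only: e1 e2 e3 diff_add_cancel)
    have "A3 (smul \<kappa> y) = 0" "A3 (\<Sum>l<r. smul (y l) (t l)) = 0"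
      by (simp_all add: A3.scale A3.sum y(2) A3t)
    then have "Q (smul f (\<Sum>i<q. smul (w i * c i) (unit_vec i))) = 0"
      using dec A3.add by (simp add: A3_sum)
    then have zero: "smul g (smul f (\<Sum>i<q. smul (w i * c i) (unit_vec i))) = 0"
      using quasi_inverseD(6)[OF Q] Q'.zero by metis
    have wc: "(g * f * w i) * c i = 0" if "i < q" for i
    proof -
      have "(\<Sum>k<q. w k * c k * unit_vec k i) = (\<Sum>k<q. if k = i then w k * c k else 0)"
        by (intro sum.cong) (auto simp: unit_vec_apply)
      then show ?thesis
        using fun_cong[OF zero, of i] that by (simp add: ac_simps)
    qed
    then have "\<forall>i. \<exists>u. i < q \<longrightarrow> \<sigma> * (g * f * w i) = u * b i"
      using ann_c by blast
    then obtain u where u: "\<And>i. i < q \<Longrightarrow> \<sigma> * (g * f * w i) = u i * b i"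
      by metis
    have "smul (\<sigma> * (g * f) * \<kappa>) y = smul (\<sigma> * (g * f)) (smul \<kappa> y)"
      by simp
    then have e4: "smul (\<sigma> * (g * f) * \<kappa>) y = smul (\<sigma> * (g * f)) (\<Sum>l<r. smul (y l) (t l)) +
        (\<Sum>i<q. smul (\<sigma> * (g * f * w i)) (x i))"
      unfolding dec by (simp add: vec.scale_right_distrib vec.scale_sum_right mult.assoc)
    have e5: "(\<Sum>i<q. smul (\<sigma> * (g * f * w i)) (x i)) = (\<Sum>i<q. smul (u i) (smul (b i) (x i)))"
      using u by (intro sum.cong) auto
    show ?thesis
      unfolding e4 e5
      by (intro vec.span_add vec.span_scale vec.span_sum vec.span_base) (auto simp: S_def)
  qed
  moreover have "\<sigma> * (g * f) * \<kappa> \<notin> M" "finite S"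
    unfolding \<kappa>_def S_def using \<sigma> fg mult_notin by simp_all
  ultimately show ?thesis
    by blast
qed

text \<open>In the reduced case each \<open>b i\<close> is zero or a unit at \<open>M\<close>, so
  the kernel of the diagonal form is spanned at \<open>M\<close> by the basis vectors with vanishing
  \<open>b i\<close>.\<close>

lemma second_syzygy_locally_fg:
  assumes red: "reduced_ring TYPE('a)"
    and A1: "linear_map A1" "\<And>v. v \<in> fvec p \<Longrightarrow> A1 v \<in> fvec m" and A2: "linear_map A2"
    and ex1: "{v \<in> fvec p. A1 v = 0} = A2 ` fvec q"
  shows "\<exists>f S. f \<notin> M \<and> finite S \<and> S \<subseteq> {v \<in> fvec q. A2 v = 0} \<and>
           (\<forall>y\<in>{v \<in> fvec q. A2 v = 0}. smul f y \<in> vec.span S)"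
proof -
  have A2_mem: "A2 v \<in> fvec p" if "v \<in> fvec q" for v
    using ex1 that by blast
  obtain f g P P' Q Q' b where fg: "f \<notin> M" "g \<notin> M"
    and P: "quasi_inverse p f P P'" and Q: "quasi_inverse q g Q Q'"
    and diag: "\<forall>v\<in>fvec q. P (A2 (Q v)) = (\<lambda>i. b i * v i)" and bp: "\<forall>i\<ge>p. b i = 0"
    by (rule diagonalization[OF A2 A2_mem])
  interpret A2: module_hom smul smul A2 by fact
  interpret Q: module_hom smul smul Q by (rule quasi_inverseD[OF Q])
  note ker = diagonal_kernel[OF A2 P Q diag]
  \<comment> \<open>If \<open>s * x = e * y\<close>, then
    \<open>(s * x)^2 = e * s * (x * y) = 0\<close>, and reducedness gives \<open>s * x = 0\<close>;
    the other case is symmetric.\<close>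
  have domain: "\<exists>s. s \<notin> M \<and> (s * x = 0 \<or> s * y = 0)" if xy: "x * y = 0" for x y
  proof -
    have nil: "u = 0" if "u * u = 0" for u :: 'a
      using red that power2_eq_square[of u] unfolding reduced_ring_def by metis
    obtain s e where s: "s \<notin> M" "s * x = e * y \<or> s * y = e * x"
      using comparable by blast
    from s(2) have "s * x = 0 \<or> s * y = 0"
    proof
      assume e: "s * x = e * y"
      have "(s * x) * (s * x) = (e * y) * (s * x)"
        by (simp only: e)
      also have "\<dots> = e * s * (x * y)"
        by (simp only: ac_simps)
      finally have "(s * x) * (s * x) = 0"
        by (simp only: xy mult_zero_right)
      then show ?thesis
        using nil[of "s * x"] by blast
    next
      assume e: "s * y = e * x"
      have "(s * y) * (s * y) = (e * x) * (s * y)"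
        by (simp only: e)
      also have "\<dots> = e * s * (x * y)"
        by (simp only: ac_simps)
      finally have "(s * y) * (s * y) = 0"
        by (simp only: xy mult_zero_right)
      then show ?thesis
        using nil[of "s * y"] by blast
    qed
    with s(1) show ?thesis
      by blast
  qed
  have local: "\<exists>s. s \<notin> M \<and> (s * b i = 0 \<or> (\<forall>x. b i * x = 0 \<longrightarrow> s * x = 0))" if i: "i < q" for i
  proof (cases "i < p \<and> (\<forall>s. s \<notin> M \<longrightarrow> s * b i \<noteq> 0)")
    case False
    then show ?thesis
      using bp one_notin by (metis mult_zero_right not_le)
  next
    case True
    then have ip: "i < p" and nz: "\<And>s. s \<notin> M \<Longrightarrow> s * b i \<noteq> 0"
      by auto
    note ann = diagonal_entry_annihilator[OF A1(1) A2 ex1 P Q diag ip i]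
    let ?V = "A1 (P' (unit_vec i))"
    \<comment> \<open>As \<open>b i\<close> is nonzero at \<open>M\<close>, every coordinate of
      \<open>?V\<close> vanishes there. Only \<open>m\<close> coordinates can be nonzero, so a
      single \<open>s\<close> kills \<open>?V\<close>, and then \<open>b i\<close> divides
      \<open>f * g * s\<close>.\<close>
    have "\<exists>s. s \<notin> M \<and> (\<forall>k\<in>{..<m}. s * ?V k = 0)"
    proof (rule exists_common_multiplier)
      show "\<exists>s. s \<notin> M \<and> s * ?V k = 0" for k
        using domain[of "b i" "?V k"] nz ann(1) by (auto simp: fun_eq_iff)
    qed (auto simp: mult.assoc)
    then obtain s where s: "s \<notin> M" "\<And>k. k < m \<Longrightarrow> s * ?V k = 0"
      by blast
    have "?V \<in> fvec m"
      using A1(2) quasi_inverseD(4)[OF P] ip by simp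
    then have "s * ?V k = 0" for k
      using s(2)[of k] by (cases "k < m") (auto simp: fvec_def)
    then have "smul s ?V = 0"
      by (simp add: fun_eq_iff)
    then obtain z where z: "f * g * s = z * b i"
      using ann(2) by blast
    have "f * g * s * x = 0" if "b i * x = 0" for x
      unfolding z using that by (simp add: mult.assoc)
    moreover have "f * g * s \<notin> M"
      using fg s(1) mult_notin by simp
    ultimately show ?thesis
      by blast
  qed
  have "\<exists>s. s \<notin> M \<and> (\<forall>i\<in>{..<q}. s * b i = 0 \<or> (\<forall>x. b i * x = 0 \<longrightarrow> s * x = 0))"
    by (rule exists_common_multiplier) (use local in \<open>auto simp: mult.assoc\<close>)
  then obtain s where s: "s \<notin> M" and sb: "\<And>i x. i < q \<Longrightarrow> s * b i \<noteq> 0 \<Longrightarrow> b i * x = 0 \<Longrightarrow> s * x = 0"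
    by blast
  \<comment> \<open>An index with \<open>s * b i\<close> nonzero contributes no generator:
    \<open>s\<close> kills that coordinate of \<open>Q' y\<close> for every \<open>y\<close> in the
    kernel.\<close>
  define G where "G = (\<lambda>i. if s * b i = 0 then Q (smul f (smul s (unit_vec i))) else 0)"
  have "G i \<in> fvec q \<and> A2 (G i) = 0" if i: "i < q" for i
  proof (cases "s * b i = 0")
    case True
    then have "b k * smul s (unit_vec i) k = 0" for k
      by (simp add: unit_vec_apply mult.commute)
    then have "A2 (Q (smul f (smul s (unit_vec i)))) = 0"
      by (intro ker(1)) (use i in simp_all)
    then show ?thesis
      using True i quasi_inverseD(3)[OF Q] by (simp add: G_def)
  next
    case False
    then show ?thesis
      by (simp add: G_def vec.subspace_0[OF subspace_fvec])
  qed
  then have "G ` {..<q} \<subseteq> {v \<in> fvec q. A2 v = 0}"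
    by auto
  moreover have "smul (f * s * g) y \<in> vec.span (G ` {..<q})" if y: "y \<in> fvec q" "A2 y = 0" for y
  proof -
    have "smul (f * s * g) y = Q (smul (f * s) (Q' y))"
      by (simp add: Q.scale quasi_inverseD(5)[OF Q])
    also have "Q' y = (\<Sum>i<q. smul (Q' y i) (unit_vec i))"
      by (rule fvec_expansion) (rule quasi_inverseD(4)[OF Q y(1)])
    also have "Q (smul (f * s) \<dots>) = (\<Sum>i<q. Q (smul (f * (s * Q' y i)) (unit_vec i)))"
      by (simp add: vec.scale_sum_right Q.sum mult.assoc)
    also have "\<dots> = (\<Sum>i<q. smul (Q' y i) (G i))"
    proof (rule sum.cong)
      fix i assume "i \<in> {..<q}"
      then show "Q (smul (f * (s * Q' y i)) (unit_vec i)) = smul (Q' y i) (G i)"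
        using sb[of i "Q' y i"] ker(2)[OF y, of i] by (auto simp: G_def Q.scale ac_simps)
    qed simp
    also have "\<dots> \<in> vec.span (G ` {..<q})"
      by (intro vec.span_sum vec.span_scale vec.span_base) auto
    finally show ?thesis .
  qed
  moreover have "f * s * g \<notin> M"
    using fg s mult_notin by simp
  ultimately show ?thesis
    by (intro exI[of _ "f * s * g"] exI[of _ "G ` {..<q}"]) auto
qed

end

section \<open>From local to global finite generation\<close>

lemma finitely_generated_if_locally:
  fixes K :: "(nat \<Rightarrow> 'a::comm_ring_1) set"
  assumes K: "vec.subspace K"
    and local: "\<And>M. maximal_ideal M \<Longrightarrow> \<exists>f S. f \<notin> M \<and> finite S \<and> S \<subseteq> K \<and> (\<forall>y\<in>K. smul f y \<in> vec.span S)"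
  shows "\<exists>S. finite S \<and> S \<subseteq> K \<and> vec.span S = K"
proof -
  \<comment> \<open>The ideal of all \<open>f\<close> that carry \<open>K\<close> into the span of a
    finite subset of \<open>K\<close>. A maximal ideal containing it would contradict
    \<open>local\<close>, so it contains \<open>1\<close>.\<close>
  define I where "I = {f. \<exists>S. finite S \<and> S \<subseteq> K \<and> (\<forall>y\<in>K. smul f y \<in> vec.span S)}"
  have "is_ideal I"
    unfolding is_ideal_def
  proof (intro conjI ballI allI)
    show "0 \<in> I"
      unfolding I_def by (auto intro!: exI[of _ "{}"])
    show "f + f' \<in> I" if ff: "f \<in> I" "f' \<in> I" for f f'
    proof -
      obtain S S' where S: "finite S" "S \<subseteq> K" "\<forall>y\<in>K. smul f y \<in> vec.span S"
        and S': "finite S'" "S' \<subseteq> K" "\<forall>y\<in>K. smul f' y \<in> vec.span S'"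
        using ff unfolding I_def by blast
      have "smul (f + f') y \<in> vec.span (S \<union> S')" if "y \<in> K" for y
        unfolding vec.scale_left_distrib
        using that S(3) S'(3) vec.span_mono[of S "S \<union> S'"] vec.span_mono[of S' "S \<union> S'"]
        by (intro vec.span_add) auto
      then show ?thesis
        using S S' unfolding I_def by (intro CollectI exI[of _ "S \<union> S'"]) auto
    qed
    show "c * f \<in> I" if f: "f \<in> I" for c f
    proof -
      obtain S where S: "finite S" "S \<subseteq> K" "\<forall>y\<in>K. smul f y \<in> vec.span S"
        using f unfolding I_def by blast
      have "smul (c * f) y \<in> vec.span S" if "y \<in> K" for y
        using vec.span_scale[of "smul f y" S c] S(3) that by simp
      then show ?thesis
        using S unfolding I_def by blast
    qed
  qed
  have "1 \<in> I"
  proof (rule ccontr)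
    assume "1 \<notin> I"
    with \<open>is_ideal I\<close> obtain M where "maximal_ideal M" "I \<subseteq> M"
      by (rule exists_maximal_ideal)
    then show False
      using local[of M] unfolding I_def by blast
  qed
  then obtain S where "finite S" "S \<subseteq> K" "\<forall>y\<in>K. y \<in> vec.span S"
    unfolding I_def by auto
  then show ?thesis
    using vec.span_minimal[of S K] K by blast
qed

section \<open>Extending presentations and bounding lambda\<close>

lemma linear_map_mat_app: "linear_map (mat_app A m k)"
  by (rule linear_mapI)
    (auto simp: mat_app_def fun_eq_iff algebra_simps sum.distrib sum_distrib_left)

lemma mat_app_in_fvec: "mat_app A m k v \<in> fvec m"
  by (simp add: mat_app_def fvec_def)

text \<open>The generators become the columns of a matrix, which turns finite generation of a kernel
  into the next map of a presentation.\<close>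

lemma exists_matrix_of_image:
  assumes "finite S" "S \<subseteq> fvec k"
  shows "\<exists>q D. mat_app D k q ` fvec q = vec.span S"
proof -
  obtain xs where xs: "set xs = S"
    using finite_list[OF assms(1)] by blast
  define q where "q = length xs"
  define D where "D = (\<lambda>i j. (xs ! j) i)"
  have mem: "xs ! j \<in> S" if "j < q" for j
    using that xs by (auto simp: q_def)
  have eq: "mat_app D k q v = (\<Sum>j<q. smul (v j) (xs ! j))" for v
  proof
    fix i
    show "mat_app D k q v i = (\<Sum>j<q. smul (v j) (xs ! j)) i"
    proof (cases "i < k")
      case True
      then show ?thesis
        by (simp add: mat_app_def D_def mult.commute)
    next
      case False
      then have "(xs ! j) i = 0" if "j < q" for j
        using mem[OF that] assms(2) by (auto simp: fvec_def)
      then show ?thesis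
        using False by (simp add: mat_app_def)
    qed
  qed
  interpret D: module_hom smul smul "mat_app D k q"
    by (rule linear_map_mat_app)
  have "mat_app D k q v \<in> vec.span S" for v
    unfolding eq using mem by (intro vec.span_sum vec.span_scale vec.span_base) auto
  moreover have "S \<subseteq> mat_app D k q ` fvec q"
  proof
    fix s assume "s \<in> S"
    then obtain j where j: "j < q" "xs ! j = s"
      using xs by (auto simp: q_def in_set_conv_nth)
    have "mat_app D k q (unit_vec j) = (\<Sum>l<q. if l = j then xs ! l else 0)"
      unfolding eq by (intro sum.cong) (auto simp: unit_vec_apply fun_eq_iff)
    then have "mat_app D k q (unit_vec j) = s"
      using j by simp
    then show "s \<in> mat_app D k q ` fvec q"
      using unit_vec_in_fvec[OF j(1)] by blast
  qed
  ultimately have "mat_app D k q ` fvec q = vec.span S"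
    using vec.span_minimal[OF _ D.subspace_image[OF subspace_fvec]] by blast
  then show ?thesis
    by blast
qed

text \<open>One more step exists once the kernel of the last map is finitely generated, which is
  checked at each maximal ideal. For \<open>n >= 3\<close> this uses the last three maps; for
  \<open>n = 2\<close> and a reduced ring, the two maps between free modules.\<close>

lemma has_fin_pres_Suc:
  fixes scale :: "'a::comm_ring_1 \<Rightarrow> 'b::ab_group_add \<Rightarrow> 'b"
  assumes ar: "arithmetic_ring TYPE('a)" and pres: "has_fin_pres scale n"
    and n: "n \<ge> 3 \<or> reduced_ring TYPE('a) \<and> n \<ge> 2"
  shows "has_fin_pres scale (Suc n)"
proof -
  obtain k D g where gen: "\<forall>x. \<exists>v\<in>fvec (k 0). aug scale g (k 0) v = x"
    and ex0: "1 \<le> n \<longrightarrow> {v \<in> fvec (k 0). aug scale g (k 0) v = 0}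
                   = mat_app (D 1) (k 0) (k 1) ` fvec (k 1)"
    and "\<forall>i. 1 \<le> i \<and> i < n \<longrightarrow> {v \<in> fvec (k i). mat_app (D i) (k (i - 1)) (k i) v = (\<lambda>_. 0)}
            = mat_app (D (Suc i)) (k i) (k (Suc i)) ` fvec (k (Suc i))"
    using pres unfolding has_fin_pres_def by (elim exE conjE) (rule that)
  then have ex: "{v \<in> fvec (k i). mat_app (D i) (k (i - 1)) (k i) v = 0}
            = mat_app (D (Suc i)) (k i) (k (Suc i)) ` fvec (k (Suc i))" if "1 \<le> i" "i < n" for i
    using that by (simp add: zero_fun_def)
  let ?d = "\<lambda>i. mat_app (D i) (k (i - 1)) (k i)"
  let ?K = "{v \<in> fvec (k n). ?d n v = 0}"
  have local: "\<exists>f S. f \<notin> M \<and> finite S \<and> S \<subseteq> ?K \<and> (\<forall>y\<in>?K. smul f y \<in> vec.span S)" if M: "maximal_ideal M" for M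
  proof -
    interpret valuation_at M
      using ar M valuation_at_maximal unfolding arithmetic_ring_def by blast
    show ?thesis
    proof (cases "n \<ge> 3")
      case True
      define j where "j = n - 3"
      with True have j: "n = Suc (Suc (Suc j))"
        by simp
      have "{v \<in> fvec (k (Suc j)). mat_app (D (Suc j)) (k j) (k (Suc j)) v = 0}
          = mat_app (D (Suc (Suc j))) (k (Suc j)) (k (Suc (Suc j))) ` fvec (k (Suc (Suc j)))"
        "{v \<in> fvec (k (Suc (Suc j))). mat_app (D (Suc (Suc j))) (k (Suc j)) (k (Suc (Suc j))) v = 0}
          = mat_app (D n) (k (Suc (Suc j))) (k n) ` fvec (k n)"
        using ex[of "Suc j"] ex[of "Suc (Suc j)"] by (simp_all add: j)
      from third_syzygy_locally_fg[OF linear_map_mat_app linear_map_mat_app linear_map_mat_app this]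
      show ?thesis
        by (simp add: j)
    next
      case False
      with n have red: "reduced_ring TYPE('a)" and n2: "n = Suc (Suc 0)"
        by auto
      have "{v \<in> fvec (k 1). mat_app (D 1) (k 0) (k 1) v = 0} = mat_app (D n) (k 1) (k n) ` fvec (k n)"
        using ex[of 1] by (simp add: n2)
      from second_syzygy_locally_fg[OF red linear_map_mat_app mat_app_in_fvec linear_map_mat_app this]
      show ?thesis
        by (simp add: n2)
    qed
  qed
  have "\<exists>S. finite S \<and> S \<subseteq> ?K \<and> vec.span S = ?K"
    by (rule finitely_generated_if_locally[OF subspace_kernel[OF linear_map_mat_app] local])
  then obtain S where S: "finite S" "S \<subseteq> ?K" "vec.span S = ?K"
    by (elim exE conjE)
  have "S \<subseteq> fvec (k n)"
    using S(2) by blast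
  then obtain q E where E: "mat_app E (k n) q ` fvec q = ?K"
    using exists_matrix_of_image[OF S(1), of "k n"] S(3) by metis
  \<comment> \<open>Only index \<open>Suc n\<close> changes, so the earlier exactness persists and
    the new condition is the one at \<open>i = n\<close>.\<close>
  let ?k = "k(Suc n := q)" and ?D = "D(Suc n := E)"
  have "n \<ge> 2"
    using n by auto
  show ?thesis
    unfolding has_fin_pres_def
  proof (intro exI[of _ ?k] exI[of _ ?D] exI[of _ g] conjI allI impI)
    show "\<exists>v\<in>fvec (?k 0). aug scale g (?k 0) v = x" for x
      using gen by simp
    show "{v \<in> fvec (?k 0). aug scale g (?k 0) v = 0} = mat_app (?D 1) (?k 0) (?k 1) ` fvec (?k 1)"
      using ex0 \<open>n \<ge> 2\<close> by simp
    fix i assume i: "1 \<le> i \<and> i < Suc n"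
    then have "i - 1 \<noteq> Suc n" "i \<noteq> Suc n"
      by auto
    then have k: "?k (i - 1) = k (i - 1)" "?k i = k i" "?D i = D i"
      by simp_all
    show "{v \<in> fvec (?k i). mat_app (?D i) (?k (i - 1)) (?k i) v = (\<lambda>_. 0)}
            = mat_app (?D (Suc i)) (?k i) (?k (Suc i)) ` fvec (?k (Suc i))"
    proof (cases "i = n")
      case True
      then show ?thesis
        using E unfolding k by (simp add: zero_fun_def)
    next
      case False
      then show ?thesis
        using ex[of i] i unfolding k by (simp add: zero_fun_def)
    qed
  qed
qed

text \<open>Lengths are integers, so without a presentation of length at least \<open>N\<close> the
  supremum would be at most \<open>N - 1\<close>. From one such length \<open>step\<close> climbs
  through all larger ones, and the supremum is unbounded.\<close>

lemma lambda_R_infinite: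
  assumes step: "\<And>n. n \<ge> N \<Longrightarrow> has_fin_pres scale n \<Longrightarrow> has_fin_pres scale (Suc n)"
    and ge: "lambda_R scale \<ge> ereal (real N)"
  shows "lambda_R scale = \<infinity>"
proof -
  let ?A = "{ereal (real n) | n. has_fin_pres scale n}"
  have "has_fin_pres scale 0"
  proof (rule ccontr)
    assume "\<not> has_fin_pres scale 0"
    with ge have "ereal (real N) \<le> ereal (- 1)"
      by (simp add: lambda_R_def one_ereal_def)
    then show False
      by simp
  qed
  then have lam: "lambda_R scale = Sup ?A"
    by (simp add: lambda_R_def)
  have "\<exists>n\<ge>N. has_fin_pres scale n"
  proof (rule ccontr)
    assume none: "\<not> (\<exists>n\<ge>N. has_fin_pres scale n)"
    have "Sup ?A \<le> ereal (real N - 1)"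
    proof (rule Sup_least)
      fix x assume "x \<in> ?A"
      then obtain n where "x = ereal (real n)" "has_fin_pres scale n"
        by blast
      moreover from this none have "n < N"
        by (meson not_le)
      ultimately show "x \<le> ereal (real N - 1)"
        by simp
    qed
    with ge lam have "ereal (real N) \<le> ereal (real N - 1)"
      by (metis order_trans)
    then show False
      by simp
  qed
  then obtain n0 where n0: "n0 \<ge> N" "has_fin_pres scale n0"
    by blast
  have all: "has_fin_pres scale (n0 + j)" for j
    by (induction j) (use n0 step in auto)
  have "ereal B \<le> Sup ?A" for B
  proof -
    obtain j :: nat where "B \<le> real j"
      using real_arch_simple by blast
    then have "ereal B \<le> ereal (real (n0 + j))"
      by simp
    also have "\<dots> \<le> Sup ?A"
      using all by (intro Sup_upper) blast
    finally show ?thesis .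
  qed
  then show ?thesis
    unfolding lam by (rule ereal_top)
qed

theorem theorem2p1:
  fixes scale :: "'a::comm_ring_1 \<Rightarrow> 'b::ab_group_add \<Rightarrow> 'b"
  assumes "arithmetic_ring TYPE('a)"
    and "module scale"
  shows "(lambda_R scale \<ge> 3 \<longrightarrow> lambda_R scale = \<infinity>) \<and>
         (reduced_ring TYPE('a) \<longrightarrow> lambda_R scale \<ge> 2 \<longrightarrow> lambda_R scale = \<infinity>)"
proof (intro conjI impI)
  assume "lambda_R scale \<ge> 3"
  then show "lambda_R scale = \<infinity>"
    using lambda_R_infinite[of 3 scale] has_fin_pres_Suc[OF assms(1)] by auto
next
  assume "reduced_ring TYPE('a)" "lambda_R scale \<ge> 2"
  then show "lambda_R scale = \<infinity>"
    using lambda_R_infinite[of 2 scale] has_fin_pres_Suc[OF assms(1)] by auto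
qed

end
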